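(* For integers $\delta>k\ge 1$, let $f(k,\delta)$ be the largest integer such that every $k$-connected graph $G$ with $|V(G)|\ge 2\delta$ and $\delta(G)\ge\delta$ has a $k$-removable $f(k,\delta)$-matching. Let $\delta$ and $k$ be integers with $\delta>k\ge 1$. The following statements hold: (i) $(\delta+1)/2\le f(k,\delta)\le\delta$ for $\delta\ge 3k-1$. (ii) $f(1,\delta)=1$ if $\delta=2$, and $f(1,\delta)=\delta$ if $\delta\ge 3$. (iii) $2\lfloor(\delta-2)/2\rfloor\le f(2,\delta)\le\delta$. (iv) $2\le f(k,k+1)\le k$ for $k\ge 2$; in particular, $f(2,3)=2$.
   Context: All graphs are finite, undirected and simple. A vertex set $S\subseteq V(G)$ with exactly $j$ vertices is a $j$-separating set if $G-S$ (the subgraph induced on $V(G)\setminus S$) is disconnected. For an integer $k\ge 1$, a graph $G$ is $k$-connected if it has no $(k-1)$-separating set; in particular, $1$-connected means connected. $\delta(G)$ is the minimum degree of $G$ (while $\delta$ alone denotes an integer). For $F\subseteq E(G)$, $G-F$ is the graph with vertex set $V(G)$ and edge set $E(G)\setminus F$. A matching is a set of pairwise vertex-disjoint edges; for $\ell\ge 1$, an $\ell$-matching is a matching of size $\ell$. A matching $M$ in a $k$-connected graph $G$ is $k$-removable if $G-M$ remains $k$-connected.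
   Formalization: The lower bound (δ+1)/2 ≤ f(k,δ) in (i) is asserted except at (k,δ)=(1,2), where it is false: the 4-cycle gives f(1,2)=1 < 3/2, as (ii) itself states; the upper bound in (i) is kept there. *)

theory Defs
  imports Complex_Main
begin

record 'a ugraph =
  verts :: "'a set"
  edges :: "'a set set"

definition simple_graph :: "'a ugraph \<Rightarrow> bool" where
  "simple_graph G \<longleftrightarrow> finite (verts G) \<and> (\<forall>e\<in>edges G. e \<subseteq> verts G \<and> card e = 2)"

definition delete_verts :: "'a ugraph \<Rightarrow> 'a set \<Rightarrow> 'a ugraph" where
  "delete_verts G S = \<lparr>verts = verts G - S, edges = {e \<in> edges G. e \<inter> S = {}}\<rparr>"

definition delete_edges :: "'a ugraph \<Rightarrow> 'a set set \<Rightarrow> 'a ugraph" where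
  "delete_edges G F = \<lparr>verts = verts G, edges = edges G - F\<rparr>"

definition degree :: "'a ugraph \<Rightarrow> 'a \<Rightarrow> nat" where
  "degree G v = card {e \<in> edges G. v \<in> e}"

text \<open>Only meaningful when the vertex set is finite and nonempty.\<close>

definition min_degree :: "'a ugraph \<Rightarrow> nat" where
  "min_degree G = Min (degree G ` verts G)"

text \<open>The graph without vertices counts as connected.  This convention does not affect
  \<open>max_removable\<close> for \<open>1 \<le> k < d\<close>, where fewer than \<open>card (verts G)\<close> vertices are deleted.\<close>

definition connected_graph :: "'a ugraph \<Rightarrow> bool" where
  "connected_graph G \<longleftrightarrow>
     (\<forall>u\<in>verts G. \<forall>v\<in>verts G. (u, v) \<in> {(x, y). {x, y} \<in> edges G}\<^sup>*)"

definition separating_set :: "nat \<Rightarrow> 'a ugraph \<Rightarrow> 'a set \<Rightarrow> bool" where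
  "separating_set j G S \<longleftrightarrow>
     S \<subseteq> verts G \<and> card S = j \<and> \<not> connected_graph (delete_verts G S)"

text \<open>Intended for \<open>k \<ge> 1\<close>, so the subtraction does not truncate.\<close>

definition k_connected :: "nat \<Rightarrow> 'a ugraph \<Rightarrow> bool" where
  "k_connected k G \<longleftrightarrow> \<not> (\<exists>S. separating_set (k - 1) G S)"

definition matching :: "'a ugraph \<Rightarrow> 'a set set \<Rightarrow> bool" where
  "matching G M \<longleftrightarrow> M \<subseteq> edges G \<and> pairwise disjnt M"

definition removable_matching :: "nat \<Rightarrow> 'a ugraph \<Rightarrow> 'a set set \<Rightarrow> bool" where
  "removable_matching k G M \<longleftrightarrow> matching G M \<and> k_connected k (delete_edges G M)"

text \<open>Every finite graph is isomorphic to one whose vertices are natural numbers, so ranging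
  over graphs on \<open>nat\<close> covers all finite graphs.  The value \<open>0\<close> is always admissible (the empty
  matching).  For \<open>1 \<le> k < d\<close> the admissible values are bounded, since the complete bipartite
  graph with both sides of size \<open>d\<close> satisfies the hypotheses and has no matching of size
  greater than \<open>d\<close>; hence the greatest value exists.\<close>

definition max_removable :: "nat \<Rightarrow> nat \<Rightarrow> nat" where
  "max_removable k d = (GREATEST l.
     \<forall>G :: nat ugraph.
       simple_graph G \<and> k_connected k G \<and> card (verts G) \<ge> 2 * d \<and> min_degree G \<ge> d \<longrightarrow>
       (\<exists>M. removable_matching k G M \<and> card M = l))"

end

theory Submission
  imports Defs
begin

text \<open>The lower bounds rest on a theorem of Mader: if \<open>G\<close> is \<open>k\<close>-connected and \<open>X\<close> is a nonempty set of
vertices of degree more than \<open>k\<close>, each with at least two neighbours in \<open>X\<close>, then some edge inside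
\<open>X\<close> can be deleted without losing \<open>k\<close>-connectedness (\<open>mader_removable_edge\<close>). Let \<open>M\<close> be a
removable matching of \<open>G\<close> that cannot be enlarged, \<open>W\<close> the set of its \<open>2 * card M\<close> end vertices and
\<open>R\<close> the remaining vertices. Vertices of \<open>R\<close> have degree at least \<open>\<delta> > k\<close> in \<open>G - M\<close>, so by Mader's
theorem \<open>G - M\<close> induces a forest on \<open>R\<close> (\<open>low_vertex\<close>).

Two vertices \<open>r\<close> and \<open>s\<close> of \<open>R\<close> with at most one neighbour in \<open>R\<close> send at least \<open>2 * \<delta> - 2\<close> edges to
\<open>W\<close>. If \<open>card M < \<delta> - 1\<close>, then some edge \<open>ab\<close> of \<open>M\<close> receives three of them, say \<open>ra\<close>, \<open>rb\<close> and \<open>sb\<close>,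
and \<open>M - ab + ra + sb\<close> is a larger matching. Suppose that deleting it leaves a separator of fewer than
\<open>k\<close> vertices. One of \<open>ra\<close> and \<open>sb\<close> joins the two sides; let \<open>B\<close> be the side of its covered end. A
vertex of the forest on \<open>B \<inter> R\<close> with at most one neighbour there has its other neighbours in \<open>W \<inter> B\<close>
or in the separator, so \<open>B\<close> contains at least \<open>\<delta> - k\<close> vertices of \<open>W\<close>; and at least \<open>\<delta> - 2\<close> neighbours
in \<open>W\<close> of the uncovered end lie outside \<open>B\<close>. Hence \<open>2 * card M \<ge> 2 * \<delta> - k - 2\<close>
(\<open>stuck_matching_size\<close>), and all \<open>l\<close> with \<open>2 * l + k + 1 \<le> 2 * \<delta>\<close> are admissible
(\<open>guaranteed_general\<close>). This suffices for \<open>(\<delta> + 1) / 2\<close> when \<open>k \<ge> 2\<close> and \<open>\<delta> \<ge> 3 * k - 1\<close>, for \<open>\<delta> - 2\<close>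
when \<open>k = 2\<close>, for 2 when \<open>\<delta> = k + 1\<close> and \<open>k \<ge> 3\<close>, and for 1 when \<open>k = 1\<close> and \<open>\<delta> = 2\<close>. For the last edge when \<open>k = 1\<close> and \<open>\<delta> \<ge> 3\<close>, and for the second edge when \<open>k = 2\<close> and \<open>\<delta> = 3\<close>, the exchange is
refined by hand (\<open>not_stuck_1\<close> and \<open>not_stuck_2_3\<close>).

The upper bound \<open>\<delta>\<close> comes from the complete bipartite graph with sides of size \<open>\<delta>\<close>. For \<open>\<delta> = k + 1\<close>
the better bound \<open>k\<close> comes from the join of \<open>k - 1\<close> independent vertices, the hubs, with a cycle: at
most \<open>k - 1\<close> edges of a matching meet the hubs, and at most one edge of the cycle can be deleted,
because the cycle has to stay connected when the hubs are removed.\<close>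

section \<open>Cuts and neighbourhoods\<close>

definition nbrs :: "'a set set \<Rightarrow> 'a \<Rightarrow> 'a set" where
  "nbrs E v = {u. {v, u} \<in> E}"

definition cut :: "'a set \<Rightarrow> 'a set set \<Rightarrow> 'a set \<Rightarrow> 'a set \<Rightarrow> 'a set \<Rightarrow> bool" where
  "cut V E A S B \<longleftrightarrow> A \<union> S \<union> B = V \<and> A \<inter> S = {} \<and> A \<inter> B = {} \<and> S \<inter> B = {} \<and>
     A \<noteq> {} \<and> B \<noteq> {} \<and> (\<forall>x\<in>A. \<forall>y\<in>B. {x, y} \<notin> E)"

text \<open>Bounding all separators from below, instead of excluding those of one size, makes the cut
arguments free of padding: any separator that turns out too small is a contradiction at once.\<close>

definition kcon :: "nat \<Rightarrow> 'a set \<Rightarrow> 'a set set \<Rightarrow> bool" where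
  "kcon k V E \<longleftrightarrow> (\<forall>A S B. cut V E A S B \<longrightarrow> k \<le> card S)"

lemma nbrs_iff: "u \<in> nbrs E v \<longleftrightarrow> {v, u} \<in> E"
  by (simp add: nbrs_def)

lemma nbrs_sym: "u \<in> nbrs E v \<longleftrightarrow> v \<in> nbrs E u"
  by (simp add: nbrs_def insert_commute)

lemma nbrs_subset:
  assumes "\<forall>e\<in>E. e \<subseteq> V \<and> card e = 2"
  shows "nbrs E v \<subseteq> V - {v}"
proof
  fix u assume "u \<in> nbrs E v"
  then have "{v, u} \<subseteq> V" "card {v, u} = 2" using assms by (auto simp: nbrs_def)
  then show "u \<in> V - {v}" by auto
qed

lemma cut_sym: "cut V E A S B \<Longrightarrow> cut V E B S A"
  unfolding cut_def by (simp add: Int_commute Un_commute Un_left_commute, metis insert_commute)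

lemma cut_no_edge: "cut V E A S B \<Longrightarrow> x \<in> A \<Longrightarrow> {x, y} \<in> E \<Longrightarrow> y \<notin> B"
  unfolding cut_def by blast

lemma card_split_cut:
  assumes "cut V E A S B" "finite V" "X \<subseteq> V"
  shows "card X = card (X \<inter> A) + card (X \<inter> S) + card (X \<inter> B)"
proof -
  have fX: "finite X" using assms finite_subset by blast
  have "X = (X \<inter> A \<union> X \<inter> S) \<union> X \<inter> B" using assms unfolding cut_def by blast
  moreover have "card ((X \<inter> A \<union> X \<inter> S) \<union> X \<inter> B) = card (X \<inter> A \<union> X \<inter> S) + card (X \<inter> B)"
    by (rule card_Un_disjoint) (use assms(1) fX in \<open>auto simp: cut_def\<close>)
  moreover have "card (X \<inter> A \<union> X \<inter> S) = card (X \<inter> A) + card (X \<inter> S)"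
    by (rule card_Un_disjoint) (use assms(1) fX in \<open>auto simp: cut_def\<close>)
  ultimately show ?thesis by metis
qed

lemma card_Un3:
  assumes "finite X" "finite Y" "finite Z" "X \<inter> Y = {}" "X \<inter> Z = {}" "Y \<inter> Z = {}"
  shows "card (X \<union> Y \<union> Z) = card X + card Y + card Z"
  using assms by (simp add: card_Un_disjoint Int_Un_distrib2)

text \<open>The form in which \<open>k\<close>-connectedness is used: a set \<open>N\<close> that contains all neighbours of \<open>X\<close>
outside \<open>X\<close>, and misses some further vertex \<open>z\<close>, separates \<open>X\<close> from \<open>z\<close>.\<close>

lemma kcon_separator:
  assumes "kcon k V E" "X \<subseteq> V" "X \<noteq> {}" "N \<subseteq> V" "X \<inter> N = {}"
    and "\<And>x. x \<in> X \<Longrightarrow> nbrs E x \<subseteq> X \<union> N" and "z \<in> V" "z \<notin> X" "z \<notin> N"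
  shows "k \<le> card N"
proof -
  have "cut V E X N (V - X - N)"
    unfolding cut_def
  proof (intro conjI ballI notI)
    show "False" if "x \<in> X" "y \<in> V - X - N" "{x, y} \<in> E" for x y
      using assms(6)[OF that(1)] that(2,3) by (auto simp: nbrs_iff)
  qed (use assms in auto)
  then show ?thesis using assms(1) unfolding kcon_def by blast
qed

lemma card_degree:
  assumes "\<forall>e\<in>E. card e = 2"
  shows "card {e \<in> E. v \<in> e} = card (nbrs E v)"
proof -
  have "bij_betw (\<lambda>u. {v, u}) (nbrs E v) {e \<in> E. v \<in> e}"
  proof (rule bij_betwI')
    show "({v, x} = {v, y}) = (x = y)" for x y by (auto simp: doubleton_eq_iff)
    show "{v, x} \<in> {e \<in> E. v \<in> e}" if "x \<in> nbrs E v" for x using that by (simp add: nbrs_iff)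
    fix e assume e: "e \<in> {e \<in> E. v \<in> e}"
    then obtain p q where "e = {p, q}" using assms by (auto simp: card_2_iff)
    with e show "\<exists>u\<in>nbrs E v. e = {v, u}" by (auto simp: nbrs_iff insert_commute)
  qed
  then show ?thesis by (simp add: bij_betw_same_card)
qed

text \<open>With more than \<open>k\<close> vertices, a separator of fewer than \<open>k - 1\<close> vertices can be padded to exactly
\<open>k - 1\<close> without exhausting either side, so the two notions agree.\<close>

lemma k_connected_iff_kcon:
  assumes G: "simple_graph G" and k: "1 \<le> k" "k < card (verts G)"
  shows "k_connected k G \<longleftrightarrow> kcon k (verts G) (edges G)"
proof
  assume kc: "kcon k (verts G) (edges G)"
  show "k_connected k G"
    unfolding k_connected_def
  proof
    assume "\<exists>S. separating_set (k - 1) G S"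
    then obtain S where S: "S \<subseteq> verts G" "card S = k - 1"
      and dis: "\<not> connected_graph (delete_verts G S)"
      by (auto simp: separating_set_def)
    define r where "r = {(x, y). {x, y} \<in> edges (delete_verts G S)}"
    from dis obtain u v where uv: "u \<in> verts G - S" "v \<in> verts G - S" "(u, v) \<notin> r\<^sup>*"
      by (auto simp: connected_graph_def r_def delete_verts_def)
    define A where "A = {w \<in> verts G - S. (u, w) \<in> r\<^sup>*}"
    have "cut (verts G) (edges G) A S (verts G - S - A)"
      unfolding cut_def
    proof (intro conjI ballI notI)
      fix x y assume x: "x \<in> A" and y: "y \<in> verts G - S - A" and e: "{x, y} \<in> edges G"
      have "(x, y) \<in> r" using x y e by (auto simp: r_def delete_verts_def A_def)
      then have "y \<in> A" using x y by (auto simp: A_def intro: rtrancl_into_rtrancl)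
      with y show False by blast
    qed (use S uv in \<open>auto simp: A_def\<close>)
    then have "k \<le> k - 1" using kc S unfolding kcon_def by metis
    then show False using k by simp
  qed
next
  assume kc: "k_connected k G"
  show "kcon k (verts G) (edges G)"
    unfolding kcon_def
  proof (intro allI impI, rule ccontr)
    fix A S B assume c: "cut (verts G) (edges G) A S B" and "\<not> k \<le> card S"
    then have S: "card S \<le> k - 1" by simp
    have fin: "finite (verts G)" using G by (simp add: simple_graph_def)
    obtain a b where ab: "a \<in> A" "b \<in> B" using c unfolding cut_def by blast
    have sub: "S \<subseteq> verts G - {a, b}" "a \<in> verts G" "b \<in> verts G" "a \<noteq> b"
      using c ab unfolding cut_def by auto
    have "k - 1 \<le> card (verts G - {a, b})"
      using sub k fin by (simp add: card_Diff_subset)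
    then obtain S' where S': "S \<subseteq> S'" "S' \<subseteq> verts G - {a, b}" "card S' = k - 1"
      using exists_subset_between[OF S _ sub(1)] fin by auto
    have "separating_set (k - 1) G S'"
      unfolding separating_set_def
    proof (intro conjI notI)
      assume "connected_graph (delete_verts G S')"
      then have "(a, b) \<in> {(x, y). {x, y} \<in> edges (delete_verts G S')}\<^sup>*"
        unfolding connected_graph_def using sub S'(2) by (auto simp: delete_verts_def)
      then have "b \<in> A"
      proof (induction rule: rtrancl_induct)
        case base
        show ?case by (rule ab)
      next
        case (step y z)
        then have yz: "{y, z} \<in> edges G" "z \<notin> S'" by (auto simp: delete_verts_def)
        have "z \<in> verts G" using yz G by (auto simp: simple_graph_def)
        with yz step.IH S'(1) c show ?case unfolding cut_def by blast
      qed
      with ab c show False unfolding cut_def by blast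
    qed (use S' in auto)
    then show False using kc unfolding k_connected_def by blast
  qed
qed

section \<open>Mader's theorem on critical edges\<close>

text \<open>This is the uncrossing step. Two critical edges \<open>xy\<close> and \<open>xw\<close> at \<open>x\<close> give two cuts with separators
\<open>S\<close> and \<open>S'\<close> of fewer than \<open>k\<close> vertices. The corner separators \<open>P\<close> around \<open>A \<inter> A'\<close> and \<open>Q\<close> around
\<open>B \<inter> B'\<close> satisfy \<open>card P + card Q = card S + card S'\<close>. Since \<open>x\<close> has more than \<open>k\<close> neighbours,
\<open>P\<close> has at least \<open>k - 1\<close> elements; so \<open>Q\<close> has fewer than \<open>k\<close>, the corner \<open>B \<inter> B'\<close> must be empty,
and comparing the remaining parts shows that \<open>A\<close> exceeds \<open>B'\<close> at least by the vertex \<open>x\<close>.\<close>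

lemma crossing_cuts:
  assumes fin: "finite V" and E: "\<forall>e\<in>E. e \<subseteq> V \<and> card e = 2" and kc: "kcon k V E"
    and xy: "{x, y} \<in> E" and xw: "{x, w} \<in> E" and wy: "w \<noteq> y" and deg: "k < card (nbrs E x)"
    and c: "cut V (E - {{x, y}}) A S B" "card S < k" "x \<in> A" "y \<in> B"
    and c': "cut V (E - {{x, w}}) A' S' B'" "card S' < k" "x \<in> A'" "w \<in> B'"
  shows "card B' < card A"
proof -
  have parts: "A \<union> S \<union> B = V" "A \<inter> S = {}" "A \<inter> B = {}" "S \<inter> B = {}"
    "A' \<union> S' \<union> B' = V" "A' \<inter> S' = {}" "A' \<inter> B' = {}" "S' \<inter> B' = {}"
    using c(1) c'(1) unfolding cut_def by auto
  note disj = parts(2-4,6-8)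
  have inV: "v \<in> A \<union> S \<union> B \<and> v \<in> A' \<union> S' \<union> B'" if "v \<in> V" for v using that parts(1,5) by simp
  have subs: "A \<subseteq> V" "S \<subseteq> V" "A' \<subseteq> V" "S' \<subseteq> V" "B' \<subseteq> V" using parts(1,5) by auto
  have fins: "finite A" "finite S" "finite B" "finite A'" "finite S'" "finite B'"
  proof -
    have "finite (A \<union> S \<union> B)" "finite (A' \<union> S' \<union> B')" using fin parts(1,5) by simp_all
    then show "finite A" "finite S" "finite B" "finite A'" "finite S'" "finite B'" by simp_all
  qed
  have edgeV: "v \<in> V \<and> v \<noteq> u" if "{u, v} \<in> E" for u v
    using E that by fastforce
  have noAB: "v \<notin> B" if "u \<in> A" "{u, v} \<in> E" "{u, v} \<noteq> {x, y}" for u v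
    using c(1) that unfolding cut_def by blast
  have noBA: "v \<notin> A" if "u \<in> B" "{u, v} \<in> E" "{u, v} \<noteq> {x, y}" for u v
    using cut_sym[OF c(1)] that unfolding cut_def by blast
  have noAB': "v \<notin> B'" if "u \<in> A'" "{u, v} \<in> E" "{u, v} \<noteq> {x, w}" for u v
    using c'(1) that unfolding cut_def by blast
  have noBA': "v \<notin> A'" if "u \<in> B'" "{u, v} \<in> E" "{u, v} \<noteq> {x, w}" for u v
    using cut_sym[OF c'(1)] that unfolding cut_def by blast
  have w: "w \<notin> B" using noAB[OF c(3) xw] wy by (auto simp: doubleton_eq_iff)
  have y: "y \<notin> B'" using noAB'[OF c'(3) xy] wy by (auto simp: doubleton_eq_iff)
  define P where "P = (S \<inter> A') \<union> (S \<inter> S') \<union> (A \<inter> S')"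
  define Q where "Q = (S \<inter> B') \<union> (S \<inter> S') \<union> (B \<inter> S')"
  have cardP: "card P = card (S \<inter> A') + card (S \<inter> S') + card (A \<inter> S')"
    unfolding P_def by (rule card_Un3) (use parts(2-4,6-8) fins in auto)
  have cardQ: "card Q = card (S \<inter> B') + card (S \<inter> S') + card (B \<inter> S')"
    unfolding Q_def by (rule card_Un3) (use parts(2-4,6-8) fins in auto)
  have cardS: "card S = card (S \<inter> A') + card (S \<inter> S') + card (S \<inter> B')"
    using card_split_cut[OF c'(1) fin subs(2)] .
  have cardS': "card S' = card (A \<inter> S') + card (S \<inter> S') + card (B \<inter> S')"
    using card_split_cut[OF c(1) fin subs(4)] by (simp add: Int_commute)
  have bigP: "k \<le> card P + 1"
  proof (rule ccontr)
    assume small: "\<not> k \<le> card P + 1"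
    have fP: "finite P" using fins by (auto simp: P_def)
    show False
    proof (cases "A \<inter> A' = {x}")
      case True
      have "nbrs E x \<subseteq> P \<union> {y, w}"
      proof
        fix v assume "v \<in> nbrs E x"
        then have xv: "{x, v} \<in> E" by (simp add: nbrs_iff)
        have "v \<notin> B \<or> v = y" "v \<notin> B' \<or> v = w"
          using noAB[OF c(3) xv] noAB'[OF c'(3) xv] by (auto simp: doubleton_eq_iff)
        moreover have "v \<in> A \<union> S \<union> B" "v \<in> A' \<union> S' \<union> B'" "v \<notin> A \<inter> A'"
          using edgeV[OF xv] True parts(1,5) by auto
        ultimately show "v \<in> P \<union> {y, w}" unfolding P_def by blast
      qed
      then have "card (nbrs E x) \<le> card (P \<union> {y, w})" using fP by (intro card_mono) auto
      also have "\<dots> \<le> card P + 2"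
        by (rule order_trans[OF card_Un_le]) (simp add: card_insert_if)
      finally show False using deg small by simp
    next
      case False
      have "k \<le> card (insert x P)"
      proof (rule kcon_separator[OF kc, of "A \<inter> A' - {x}" _ y])
        show "A \<inter> A' - {x} \<subseteq> V" "insert x P \<subseteq> V" "y \<in> V"
          using subs c(3,4) edgeV[OF xy] by (auto simp: P_def)
        show "A \<inter> A' - {x} \<noteq> {}" using False c(3) c'(3) by blast
        show "(A \<inter> A' - {x}) \<inter> insert x P = {}" "y \<notin> A \<inter> A' - {x}" "y \<notin> insert x P"
          using disj c(4) c(3) by (auto simp: P_def)
        fix u assume u: "u \<in> A \<inter> A' - {x}"
        show "nbrs E u \<subseteq> A \<inter> A' - {x} \<union> insert x P"
        proof
          fix v assume "v \<in> nbrs E u"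
          then have uv: "{u, v} \<in> E" by (simp add: nbrs_iff)
          have "u \<noteq> y" "u \<noteq> w" using u disj c(4) c'(4) by auto
          then have "v \<notin> B" "v \<notin> B'"
            using noAB[OF _ uv] noAB'[OF _ uv] u by (auto simp: doubleton_eq_iff)
          then show "v \<in> A \<inter> A' - {x} \<union> insert x P"
            using inV[of v] edgeV[OF uv] unfolding P_def by blast
        qed
      qed
      then show False using small fP by (simp add: card_insert_if split: if_splits)
    qed
  qed
  have empty: "B \<inter> B' = {}"
  proof (rule ccontr)
    assume ne: "B \<inter> B' \<noteq> {}"
    have "k \<le> card Q"
    proof (rule kcon_separator[OF kc _ ne, of _ x])
      show "B \<inter> B' \<subseteq> V" "Q \<subseteq> V" "x \<in> V" 
        using subs c(3) by (auto simp: Q_def)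
      show "B \<inter> B' \<inter> Q = {}" "x \<notin> B \<inter> B'" "x \<notin> Q" 
        using disj c(3) c'(3) by (auto simp: Q_def)
      fix u assume u: "u \<in> B \<inter> B'"
      show "nbrs E u \<subseteq> B \<inter> B' \<union> Q"
      proof
        fix v assume "v \<in> nbrs E u"
        then have uv: "{u, v} \<in> E" by (simp add: nbrs_iff)
        have "u \<noteq> y" "u \<noteq> w" "u \<noteq> x" using u w y c(3) disj by auto
        then have "v \<notin> A" "v \<notin> A'"
          using noBA[OF _ uv] noBA'[OF _ uv] u by (auto simp: doubleton_eq_iff)
        then show "v \<in> B \<inter> B' \<union> Q" using inV[of v] edgeV[OF uv] unfolding Q_def by blast
      qed
    qed
    then show False using bigP cardP cardQ cardS cardS' c(2) c'(2) by linarith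
  qed
  have "card B' = card (A \<inter> B') + card (S \<inter> B')"
    using card_split_cut[OF c(1) fin subs(5)] empty by (simp add: Int_commute)
  moreover have "card A = card (A \<inter> A') + card (A \<inter> S') + card (A \<inter> B')"
    using card_split_cut[OF c'(1) fin subs(1)] by simp
  moreover have "card (A \<inter> A') > 0" using c(3) c'(3) fins by (auto simp: card_gt_0_iff)
  ultimately show ?thesis using bigP cardP cardS c(2) by linarith
qed

text \<open>Mader's theorem: a subgraph of minimum degree at least 2 all of whose vertices have degree
more than \<open>k\<close> contains an edge whose deletion preserves \<open>k\<close>-connectedness. Otherwise, among all
cuts arising from edges inside \<open>X\<close>, take one with smallest side \<open>A\<close>, belonging to an end \<open>x\<close> of
its edge. A second edge at \<open>x\<close> inside \<open>X\<close> then yields, by uncrossing, a smaller side.\<close>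

lemma mader_removable_edge:
  assumes fin: "finite V" and E: "\<forall>e\<in>E. e \<subseteq> V \<and> card e = 2" and kc: "kcon k V E"
    and "X \<noteq> {}" and deg: "\<And>x. x \<in> X \<Longrightarrow> k < card (nbrs E x)"
    and two: "\<And>x. x \<in> X \<Longrightarrow> 2 \<le> card (nbrs E x \<inter> X)"
  shows "\<exists>x\<in>X. \<exists>y\<in>X. {x, y} \<in> E \<and> kcon k V (E - {{x, y}})"
proof (rule ccontr)
  assume contra: "\<not> ?thesis"
  define side where "side x y A S B \<longleftrightarrow> x \<in> X \<and> y \<in> X \<and> {x, y} \<in> E \<and>
    cut V (E - {{x, y}}) A S B \<and> card S < k \<and> x \<in> A \<and> y \<in> B" for x y A S B
  have side_sym: "side y x B S A" if "side x y A S B" for x y A S B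
    using that cut_sym unfolding side_def by (auto simp: insert_commute)
  have ex: "\<exists>A S B. side x y A S B" if "x \<in> X" "y \<in> X" "{x, y} \<in> E" for x y
  proof -
    obtain A S B where c: "cut V (E - {{x, y}}) A S B" "card S < k"
      using contra \<open>x \<in> X\<close> \<open>y \<in> X\<close> \<open>{x, y} \<in> E\<close> unfolding kcon_def by fastforce
    have "\<not> cut V E A S B" using kc c(2) unfolding kcon_def by fastforce
    have "\<exists>p\<in>A. \<exists>q\<in>B. {p, q} \<in> E"
    proof (rule ccontr)
      assume "\<not> ?thesis"
      then have "\<forall>p\<in>A. \<forall>q\<in>B. {p, q} \<notin> E" by blast
      with c(1) have "cut V E A S B" unfolding cut_def by simp
      then show False using \<open>\<not> cut V E A S B\<close> by contradiction
    qed
    then obtain p q where "p \<in> A" "q \<in> B" "{p, q} \<in> E" by blast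
    moreover from this have "{p, q} = {x, y}" using cut_no_edge[OF c(1)] by blast
    ultimately consider "x \<in> A" "y \<in> B" | "y \<in> A" "x \<in> B" by (auto simp: doubleton_eq_iff)
    then show ?thesis
    proof cases
      case 1
      then show ?thesis using that c unfolding side_def by blast
    next
      case 2
      then show ?thesis using that c cut_sym[OF c(1)] unfolding side_def by blast
    qed
  qed
  have other: "\<exists>w\<in>X. w \<noteq> y \<and> {x, w} \<in> E" if "x \<in> X" for x y
  proof (rule ccontr)
    assume "\<not> ?thesis"
    then have "nbrs E x \<inter> X \<subseteq> {y}" by (auto simp: nbrs_iff)
    then have "card (nbrs E x \<inter> X) \<le> 1" using card_mono[of "{y}"] by simp
    then show False using two[OF that] by simp
  qed
  define sizes where "sizes n \<longleftrightarrow> (\<exists>x y A S B. side x y A S B \<and> card A = n)" for n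
  obtain x0 where "x0 \<in> X" using \<open>X \<noteq> {}\<close> by blast
  then obtain n0 where "sizes n0" using ex other unfolding sizes_def by metis
  then have "sizes (LEAST n. sizes n)" by (rule LeastI)
  then obtain x y A S B where s: "side x y A S B" and A: "card A = (LEAST n. sizes n)"
    unfolding sizes_def by blast
  obtain w where w: "w \<in> X" "w \<noteq> y" "{x, w} \<in> E" using other s unfolding side_def by blast
  then obtain A' S' B' where s': "side x w A' S' B'" using ex s unfolding side_def by blast
  have "card A \<le> card B'" unfolding A using side_sym[OF s'] by (intro Least_le) (unfold sizes_def, blast)
  moreover have "card B' < card A"
    using crossing_cuts[OF fin E kc _ _ w(2) deg] s s' unfolding side_def by blast
  ultimately show False by simp
qed

section \<open>Removable matchings that cannot be enlarged\<close>

lemma matching_partner_unique: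
  assumes "pairwise disjnt M" "{v, u} \<in> M" "{v, w} \<in> M"
  shows "u = w"
proof -
  have "{v, u} = {v, w}"
  proof (rule ccontr)
    assume "{v, u} \<noteq> {v, w}"
    then have "disjnt {v, u} {v, w}" using pairwiseD[OF assms(1)] assms(2,3) by blast
    then show False by (simp add: disjnt_def)
  qed
  then show ?thesis by (auto simp: doubleton_eq_iff)
qed

lemma card_nbrs_delete_matching:
  assumes "finite V" "\<forall>e\<in>E. e \<subseteq> V \<and> card e = 2" "pairwise disjnt M"
  shows "card (nbrs E v) \<le> card (nbrs (E - M) v) + 1"
proof -
  have fin: "finite (nbrs E v)" using nbrs_subset[OF assms(2)] assms(1) finite_subset by blast
  have split: "nbrs E v \<subseteq> nbrs (E - M) v \<union> (nbrs E v \<inter> nbrs M v)" by (auto simp: nbrs_iff)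
  have "nbrs (E - M) v \<subseteq> nbrs E v" by (auto simp: nbrs_iff)
  then have fin': "finite (nbrs (E - M) v)" using fin finite_subset by blast
  have "card (nbrs E v \<inter> nbrs M v) \<le> 1"
  proof (rule ccontr)
    assume "\<not> ?thesis"
    then obtain p q where "p \<in> nbrs M v" "q \<in> nbrs M v" "p \<noteq> q"
      by (metis IntD2 card_le_Suc0_iff_eq fin finite_Int One_nat_def)
    then show False using matching_partner_unique[OF assms(3)] by (auto simp: nbrs_iff)
  qed
  moreover have "card (nbrs E v) \<le> card (nbrs (E - M) v \<union> (nbrs E v \<inter> nbrs M v))"
    using split fin fin' by (intro card_mono) auto
  ultimately show ?thesis
    using card_Un_le[of "nbrs (E - M) v" "nbrs E v \<inter> nbrs M v"] by linarith
qed

text \<open>A removable matching \<open>M\<close> such that no matching with one edge more is removable. Below, \<open>W\<close> is the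
set of vertices covered by \<open>M\<close>, \<open>R\<close> the set of vertices missed by it, and \<open>E\<close> the set of the
remaining edges.\<close>

locale stuck_matching =
  fixes V :: "'a set" and E0 M :: "'a set set" and k d :: nat
  assumes finite_V: "finite V"
    and edges: "\<forall>e\<in>E0. e \<subseteq> V \<and> card e = 2"
    and M_edges: "M \<subseteq> E0" and M_disjoint: "pairwise disjnt M"
    and kcon_M: "kcon k V (E0 - M)"
    and k_less: "k < d"
    and min_deg: "v \<in> V \<Longrightarrow> d \<le> card (nbrs E0 v)"
    and stuck: "\<lbrakk>M' \<subseteq> E0; pairwise disjnt M'; card M' = Suc (card M)\<rbrakk> \<Longrightarrow> \<not> kcon k V (E0 - M')"
begin

abbreviation E :: "'a set set" where "E \<equiv> E0 - M"
abbreviation W :: "'a set" where "W \<equiv> \<Union>M"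
abbreviation R :: "'a set" where "R \<equiv> V - W"

lemma E_edges: "\<forall>e\<in>E. e \<subseteq> V \<and> card e = 2"
  using edges by blast

lemma edgeD: "{u, v} \<in> E0 \<Longrightarrow> u \<in> V \<and> v \<in> V \<and> u \<noteq> v"
  using edges by fastforce

lemma nbrs_E_subset: "nbrs E v \<subseteq> V - {v}"
  by (rule nbrs_subset[OF E_edges])

lemma finite_nbrs: "finite (nbrs E v)"
  using nbrs_E_subset finite_V finite_subset by blast

lemma finite_M: "finite M"
proof (rule finite_subset)
  show "M \<subseteq> Pow V" using M_edges edges by blast
qed (simp add: finite_V)

lemma W_subset: "W \<subseteq> V"
  using M_edges edges by blast

lemma finite_W: "finite W"
  using W_subset finite_V finite_subset by blast

lemma card_W: "card W = 2 * card M"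
proof -
  have "\<forall>e\<in>M. card e = 2" using M_edges edges by blast
  moreover from this have "\<And>e. e \<in> M \<Longrightarrow> finite e" using card.infinite by fastforce
  ultimately show ?thesis using card_Union_disjoint[OF M_disjoint] by simp
qed

lemma card_R: "card R = card V - 2 * card M"
  using card_Diff_subset[OF finite_W W_subset] card_W by simp

lemma nbrs_R: "v \<in> R \<Longrightarrow> nbrs E v = nbrs E0 v"
  by (auto simp: nbrs_iff)

lemma deg_R: "v \<in> R \<Longrightarrow> d \<le> card (nbrs E v)"
  using nbrs_R min_deg by auto

lemma deg_E: "v \<in> V \<Longrightarrow> d \<le> card (nbrs E v) + 1"
  using card_nbrs_delete_matching[OF finite_V edges M_disjoint] min_deg order_trans by blast

lemma card_nbrs_split: "card (nbrs E v) = card (nbrs E v \<inter> W) + card (nbrs E v \<inter> R)"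
proof -
  have "nbrs E v = (nbrs E v \<inter> W) \<union> (nbrs E v \<inter> R)" using nbrs_E_subset by blast
  moreover have "card ((nbrs E v \<inter> W) \<union> (nbrs E v \<inter> R)) = card (nbrs E v \<inter> W) + card (nbrs E v \<inter> R)"
    using finite_nbrs by (intro card_Un_disjoint) auto
  ultimately show ?thesis by metis
qed

lemma R_edge_critical:
  assumes "x \<in> R" "y \<in> R" "{x, y} \<in> E"
  shows "\<not> kcon k V (E - {{x, y}})"
proof -
  have "\<forall>e\<in>M. disjnt {x, y} e" using assms by (auto simp: disjnt_def)
  then have "pairwise disjnt (insert {x, y} M)"
    using M_disjoint by (auto simp: pairwise_insert disjnt_sym)
  moreover have "card (insert {x, y} M) = Suc (card M)" using assms finite_M by simp
  ultimately have "\<not> kcon k V (E0 - insert {x, y} M)"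
    using stuck M_edges assms by blast
  moreover have "E0 - insert {x, y} M = E - {{x, y}}" by blast
  ultimately show ?thesis by simp
qed

text \<open>In \<open>E\<close> the vertices of \<open>R\<close> keep their full degree, which exceeds \<open>k\<close>, so a set \<open>X\<close> without such a
vertex would contain a removable edge by Mader's theorem, and this edge could be added to \<open>M\<close>.
In other words, \<open>E\<close> induces a forest on \<open>R\<close>.\<close>

lemma low_vertex:
  assumes "X \<subseteq> R" "X \<noteq> {}"
  shows "\<exists>v\<in>X. card (nbrs E v \<inter> X) \<le> 1"
proof (rule ccontr)
  assume contra: "\<not> ?thesis"
  have "\<exists>x\<in>X. \<exists>y\<in>X. {x, y} \<in> E \<and> kcon k V (E - {{x, y}})"
  proof (rule mader_removable_edge[OF finite_V E_edges kcon_M assms(2)])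
    show "k < card (nbrs E x)" if "x \<in> X" for x
      using deg_R[of x] that assms(1) k_less by auto
    show "2 \<le> card (nbrs E x \<inter> X)" if "x \<in> X" for x
      using contra that by force
  qed
  then show False using R_edge_critical assms(1) by blast
qed

text \<open>A forest on at least two vertices has two vertices of degree at most 1: remove one such vertex
\<open>z\<close>; as \<open>z\<close> has at most one neighbour, one of two low vertices of the rest stays low.\<close>

lemma two_low_vertices:
  assumes "X \<subseteq> R" "2 \<le> card X"
  shows "\<exists>u\<in>X. \<exists>v\<in>X. u \<noteq> v \<and> card (nbrs E u \<inter> X) \<le> 1 \<and> card (nbrs E v \<inter> X) \<le> 1"
  using assms
proof (induction "card X" arbitrary: X rule: less_induct)
  case less
  have fX: "finite X" using less.prems card.infinite by fastforce
  obtain z where z: "z \<in> X" "card (nbrs E z \<inter> X) \<le> 1"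
    using low_vertex[of X] less.prems by fastforce
  have mono: "card (nbrs E p \<inter> Y) \<le> 1" if "card (nbrs E p \<inter> Y') \<le> 1" "nbrs E p \<inter> Y \<subseteq> Y'" for p Y Y'
    using that by (meson card_mono finite_Int finite_nbrs Int_greatest Int_lower1 order_trans)
  have cz: "card (X - {z}) = card X - 1" using z fX by simp
  show ?case
  proof (cases "card X = 2")
    case True
    then obtain y where y: "X - {z} = {y}" using cz by (auto simp: card_1_singleton_iff)
    have "nbrs E y \<inter> X \<subseteq> {z}" using y nbrs_E_subset[of y] by blast
    then have "card (nbrs E y \<inter> X) \<le> 1" using card_mono[of "{z}"] by simp
    then show ?thesis using z y by blast
  next
    case False
    then have lt: "card (X - {z}) < card X" "2 \<le> card (X - {z})"
      using less.prems cz by linarith+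
    have "X - {z} \<subseteq> R" using less.prems by blast
    from less.hyps[OF lt(1) this lt(2)] obtain p q where pq: "p \<in> X - {z}" "q \<in> X - {z}" "p \<noteq> q"
      "card (nbrs E p \<inter> (X - {z})) \<le> 1" "card (nbrs E q \<inter> (X - {z})) \<le> 1"
      by blast
    have "\<not> (z \<in> nbrs E p \<and> z \<in> nbrs E q)"
    proof
      assume "z \<in> nbrs E p \<and> z \<in> nbrs E q"
      then have "{p, q} \<subseteq> nbrs E z \<inter> X" using pq nbrs_sym by fastforce
      then have "card {p, q} \<le> card (nbrs E z \<inter> X)" by (intro card_mono) (simp_all add: finite_nbrs)
      then show False using z pq by simp
    qed
    then consider "z \<notin> nbrs E p" | "z \<notin> nbrs E q" by blast
    then show ?thesis
    proof cases
      case 1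
      then have "card (nbrs E p \<inter> X) \<le> 1" using mono[OF pq(4)] by blast
      then show ?thesis using pq z by blast
    next
      case 2
      then have "card (nbrs E q \<inter> X) \<le> 1" using mono[OF pq(5)] by blast
      then show ?thesis using pq z by blast
    qed
  qed
qed

lemma low_vertex_avoiding:
  assumes "X \<subseteq> R" "2 \<le> card X"
  shows "\<exists>v\<in>X. v \<noteq> p \<and> card (nbrs E v \<inter> X) \<le> 1"
  using two_low_vertices[OF assms] by metis

text \<open>The basic augmentation: the matching edge \<open>ab\<close> is traded for the two edges \<open>ra\<close> and \<open>sb\<close> to
uncovered vertices.\<close>

definition exchange :: "'a \<Rightarrow> 'a \<Rightarrow> 'a \<Rightarrow> 'a \<Rightarrow> 'a set set" where
  "exchange a b r s = insert {r, a} (insert {s, b} (M - {{a, b}}))"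

text \<open>An exchange produces a matching with one edge more, so it must destroy \<open>k\<close>-connectedness. The
resulting cut is the starting point of all further arguments; the last two claims say which
edges certainly do not cross it.\<close>

lemma exchange_fails:
  assumes ab: "{a, b} \<in> M" and rs: "r \<in> R" "s \<in> R" "r \<noteq> s" and e: "{r, a} \<in> E" "{s, b} \<in> E"
  shows "pairwise disjnt (exchange a b r s)"
    and "\<exists>A S B. cut V (E0 - exchange a b r s) A S B \<and> card S < k"
    and "{a, b} \<in> E0 - exchange a b r s"
    and "\<And>e. e \<in> E \<Longrightarrow> e \<noteq> {r, a} \<Longrightarrow> e \<noteq> {s, b} \<Longrightarrow> e \<in> E0 - exchange a b r s"
proof -
  have neq: "a \<noteq> b" "a \<in> W" "b \<in> W" using ab M_edges edgeD by blast+
  have other: "a \<notin> e \<and> b \<notin> e \<and> r \<notin> e \<and> s \<notin> e" if "e \<in> M - {{a, b}}" for e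
  proof -
    have "disjnt {a, b} e" using pairwiseD(1)[OF M_disjoint ab, of e] that by blast
    then show ?thesis using that rs by (auto simp: disjnt_def)
  qed
  have "pairwise disjnt (M - {{a, b}})" using M_disjoint by (rule pairwise_subset) blast
  moreover have "disjnt {r, a} e" "disjnt {s, b} e" if "e \<in> M - {{a, b}}" for e
    using other[OF that] by (auto simp: disjnt_def)
  moreover have "disjnt {r, a} {s, b}" using neq rs by (auto simp: disjnt_def)
  ultimately show dis: "pairwise disjnt (exchange a b r s)"
    unfolding exchange_def by (auto simp: pairwise_insert disjnt_sym)
  have "{r, a} \<notin> insert {s, b} (M - {{a, b}})" "{s, b} \<notin> M - {{a, b}}"
    using e rs neq by (auto simp: doubleton_eq_iff)
  moreover have "card (M - {{a, b}}) = card M - 1" "card M \<ge> 1"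
    using ab finite_M by (auto simp: Suc_le_eq card_gt_0_iff)
  ultimately have "card (exchange a b r s) = Suc (card M)"
    unfolding exchange_def using finite_M by simp
  moreover have "exchange a b r s \<subseteq> E0" using e M_edges by (auto simp: exchange_def)
  ultimately have "\<not> kcon k V (E0 - exchange a b r s)" using stuck dis by blast
  then show "\<exists>A S B. cut V (E0 - exchange a b r s) A S B \<and> card S < k"
    unfolding kcon_def by (auto simp: not_le)
  show "{a, b} \<in> E0 - exchange a b r s"
    using ab M_edges rs neq by (auto simp: exchange_def doubleton_eq_iff)
  show "e \<in> E0 - exchange a b r s" if "e \<in> E" "e \<noteq> {r, a}" "e \<noteq> {s, b}" for e
    using that by (auto simp: exchange_def)
qed

text \<open>By averaging, some matching edge meets \<open>X\<close> and \<open>Y\<close> in at least three incidences in total.\<close>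

lemma crowded_matching_edge:
  assumes "card W < card (X \<inter> W) + card (Y \<inter> W)"
  shows "\<exists>a b. {a, b} \<in> M \<and> (a \<in> X \<and> b \<in> X \<and> b \<in> Y \<or> a \<in> Y \<and> b \<in> Y \<and> b \<in> X)"
proof -
  have fin: "finite e" if "e \<in> M" for e using that M_edges edges card.infinite by fastforce
  have count: "card (Z \<inter> W) = (\<Sum>e\<in>M. card (Z \<inter> e))" for Z
  proof -
    have "card (\<Union>e\<in>M. Z \<inter> e) = (\<Sum>e\<in>M. card (Z \<inter> e))"
    proof (rule card_UN_disjoint[OF finite_M])
      show "\<forall>i\<in>M. \<forall>j\<in>M. i \<noteq> j \<longrightarrow> Z \<inter> i \<inter> (Z \<inter> j) = {}"
      proof (intro ballI impI)
        fix i j assume "i \<in> M" "j \<in> M" "i \<noteq> j"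
        then have "i \<inter> j = {}" using pairwiseD(1)[OF M_disjoint] by (simp add: disjnt_def)
        then show "Z \<inter> i \<inter> (Z \<inter> j) = {}" by blast
      qed
    qed (use fin in auto)
    moreover have "Z \<inter> W = (\<Union>e\<in>M. Z \<inter> e)" by blast
    ultimately show ?thesis by metis
  qed
  have "\<exists>e\<in>M. 2 < card (X \<inter> e) + card (Y \<inter> e)"
  proof (rule ccontr)
    assume "\<not> ?thesis"
    then have "\<And>e. e \<in> M \<Longrightarrow> card (X \<inter> e) + card (Y \<inter> e) \<le> 2" by (meson not_le)
    then have "(\<Sum>e\<in>M. card (X \<inter> e) + card (Y \<inter> e)) \<le> (\<Sum>e\<in>M. 2)" by (rule sum_mono)
    then have "card (X \<inter> W) + card (Y \<inter> W) \<le> 2 * card M"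
      unfolding count sum.distrib by simp
    then show False using assms card_W by simp
  qed
  then obtain e where e: "e \<in> M" "2 < card (X \<inter> e) + card (Y \<inter> e)" by blast
  then have "card e = 2" using M_edges edges by blast
  then obtain a b where ab: "e = {a, b}" "a \<noteq> b" by (auto simp: card_2_iff)
  have *: "card (Z \<inter> {a, b}) = (if a \<in> Z then 1 else 0) + (if b \<in> Z then 1 else 0)" for Z
    using ab(2) by (auto simp: Int_insert_right)
  have "{b, a} \<in> M" "{a, b} \<in> M" using e ab by (auto simp: insert_commute)
  then show ?thesis using e(2) unfolding ab(1) * by (auto split: if_splits)
qed

text \<open>A small cut forces many covered vertices. On the side \<open>B\<close>, a vertex \<open>v\<close> of \<open>B \<inter> R\<close> with at most
\<open>t\<close> neighbours in \<open>B \<inter> R\<close> has all its other neighbours in \<open>S\<close> or in \<open>W \<inter> B\<close>, so \<open>W \<inter> B\<close> has at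
least \<open>d - t - (k - 1)\<close> elements; if \<open>B \<inter> R\<close> is empty, the neighbours of \<open>w\<close> give the same. All
neighbours of \<open>q\<close> in \<open>W\<close> except possibly \<open>w\<close> lie outside \<open>B\<close> and are counted in addition.\<close>

lemma augmentation_count:
  assumes M': "pairwise disjnt M'" and c: "cut V (E0 - M') A S B" "card S < k"
    and q: "nbrs E q \<subseteq> A \<union> S \<union> {w}" and w: "w \<in> B" "w \<in> W"
    and B: "\<And>v. v \<in> B \<Longrightarrow> v \<in> R \<Longrightarrow> nbrs E v \<subseteq> B \<union> S"
    and t: "t \<le> 1" and low: "\<And>X. X \<subseteq> R \<Longrightarrow> X \<noteq> {} \<Longrightarrow> \<exists>v\<in>X. card (nbrs E v \<inter> X) \<le> t"
  shows "d + card (nbrs E q \<inter> W) \<le> 2 * card M + k + t"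
proof -
  have parts: "A \<union> S \<union> B = V" "A \<inter> S = {}" "A \<inter> B = {}" "S \<inter> B = {}"
    using c(1) unfolding cut_def by auto
  have fins: "finite S" "finite B"
  proof -
    have "finite (A \<union> S \<union> B)" using finite_V parts(1) by simp
    then show "finite S" "finite B" by simp_all
  qed
  have W_B: "d + 1 \<le> card (W \<inter> B) + k + t"
  proof (cases "B \<inter> R = {}")
    case True
    have BW: "B \<subseteq> W" using True parts(1) by blast
    have "nbrs (E0 - M') w \<subseteq> (B - {w}) \<union> S"
    proof
      fix v assume "v \<in> nbrs (E0 - M') w"
      then have v: "{w, v} \<in> E0 - M'" by (simp add: nbrs_iff)
      then have "v \<notin> A" using cut_no_edge[OF cut_sym[OF c(1)] w(1)] by blast
      moreover have "v \<in> A \<union> S \<union> B" "v \<noteq> w" using v edgeD parts(1) by auto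
      ultimately show "v \<in> (B - {w}) \<union> S" by blast
    qed
    then have "card (nbrs (E0 - M') w) \<le> card ((B - {w}) \<union> S)"
      using fins by (intro card_mono) auto
    also have "\<dots> \<le> card (B - {w}) + card S" by (rule card_Un_le)
    finally have "d \<le> card (B - {w}) + card S + 1"
      using card_nbrs_delete_matching[OF finite_V edges M', of w] min_deg[of w] w W_subset by fastforce
    moreover have "card (B - {w}) + 1 = card B" using w(1) fins(2) card_Suc_Diff1 by fastforce
    moreover have "W \<inter> B = B" using BW by blast
    ultimately show ?thesis using c(2) by simp
  next
    case False
    then obtain v where v: "v \<in> B \<inter> R" "card (nbrs E v \<inter> (B \<inter> R)) \<le> t" using low[of "B \<inter> R"] by blast
    have "nbrs E v \<subseteq> (nbrs E v \<inter> (B \<inter> R)) \<union> (W \<inter> B) \<union> S"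
      using B[of v] v(1) nbrs_E_subset[of v] by blast
    then have "card (nbrs E v) \<le> card ((nbrs E v \<inter> (B \<inter> R)) \<union> (W \<inter> B) \<union> S)"
      using fins by (intro card_mono) (auto simp: finite_nbrs)
    also have "\<dots> \<le> card (nbrs E v \<inter> (B \<inter> R)) + card (W \<inter> B) + card S"
      using card_Un_le[of "(nbrs E v \<inter> (B \<inter> R)) \<union> (W \<inter> B)" S]
        card_Un_le[of "nbrs E v \<inter> (B \<inter> R)" "W \<inter> B"] by linarith
    finally show ?thesis using v c(2) deg_R[of v] by fastforce
  qed
  have "nbrs E q \<inter> W \<subseteq> insert w (W - B)" using q parts by blast
  then have "card (nbrs E q \<inter> W) \<le> card (insert w (W - B))"
    using finite_W by (intro card_mono) auto
  also have "\<dots> \<le> card (W - B) + 1" using finite_W by (simp add: card_insert_if)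
  finally have "card (nbrs E q \<inter> W) \<le> card (W - B) + 1" .
  moreover have "card W = card (W \<inter> B) + card (W - B)"
    using card_Int_Diff[OF finite_W] by simp
  ultimately show ?thesis using W_B card_W by linarith
qed

text \<open>When the exchange of \<open>ab\<close> for \<open>ra\<close> and \<open>sb\<close> leaves a small cut, one of the deleted edges must cross
it. The remaining path \<open>r b a\<close> controls where the other vertices lie: if \<open>ra\<close> crosses, then \<open>b\<close> is in
the separator, and if \<open>sb\<close> crosses, then \<open>a\<close> is not on the side of \<open>s\<close>. So on the side \<open>B\<close> of the
covered end of the crossing edge, a vertex of \<open>R\<close> that lost an edge still has the other end of it
in \<open>B\<close> or in the separator, and the count above applies.\<close>

lemma failed_exchange_bound:
  assumes ab: "{a, b} \<in> M" and rs: "r \<in> R" "s \<in> R" "r \<noteq> s"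
    and e: "{r, a} \<in> E" "{r, b} \<in> E" "{s, b} \<in> E"
    and t: "t \<le> 1" and low: "\<And>X. X \<subseteq> R \<Longrightarrow> X \<noteq> {} \<Longrightarrow> \<exists>v\<in>X. card (nbrs E v \<inter> X) \<le> t"
  shows "d + card (nbrs E r \<inter> W) \<le> 2 * card M + k + t \<or> d + card (nbrs E s \<inter> W) \<le> 2 * card M + k + t"
proof -
  let ?E' = "E0 - exchange a b r s"
  note ex = exchange_fails[OF ab rs e(1,3)]
  have neq: "a \<noteq> b" "a \<in> W" "b \<in> W" using ab M_edges edgeD by blast+
  have rb: "{r, b} \<in> ?E'" using ex(4)[OF e(2)] rs neq by (auto simp: doubleton_eq_iff)
  note ab' = ex(3)
  have kept: "{x, y} \<in> ?E'" if "{x, y} \<in> E" "x = r \<Longrightarrow> y \<noteq> a" "y = r \<Longrightarrow> x \<noteq> a"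
    "x = s \<Longrightarrow> y \<noteq> b" "y = s \<Longrightarrow> x \<noteq> b" for x y
    using ex(4)[OF that(1)] that by (auto simp: doubleton_eq_iff)
  have caseI: "d + card (nbrs E r \<inter> W) \<le> 2 * card M + k + t"
    if c: "cut V ?E' A S B" "card S < k" "r \<in> A" "a \<in> B" for A S B
  proof (rule augmentation_count[OF ex(1) c(1,2) _ c(4) neq(2) _ t low])
    have inV: "v \<in> A \<union> S \<union> B" if "v \<in> V" for v using c(1) that unfolding cut_def by simp
    have "b \<notin> B" using cut_no_edge[OF c(1,3) rb] .
    moreover have "b \<notin> A" using cut_no_edge[OF cut_sym[OF c(1)] c(4) ab'] .
    ultimately have b: "b \<in> S" using inV neq W_subset by blast
    have disj: "b \<notin> A" "b \<notin> B" by fact+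
    have rB: "r \<notin> B" using c(1,3) unfolding cut_def by blast
    show "nbrs E r \<subseteq> A \<union> S \<union> {a}"
    proof
      fix v assume "v \<in> nbrs E r"
      then have v: "{r, v} \<in> E" by (simp add: nbrs_iff)
      show "v \<in> A \<union> S \<union> {a}"
      proof (cases "v = a")
        case False
        then have "{r, v} \<in> ?E'" using kept[OF v] rs neq by blast
        then show ?thesis using cut_no_edge[OF c(1,3)] inV[of v] v edgeD by blast
      qed simp
    qed
    fix v assume v: "v \<in> B" "v \<in> R"
    show "nbrs E v \<subseteq> B \<union> S"
    proof
      fix u assume "u \<in> nbrs E v"
      then have u: "{v, u} \<in> E" by (simp add: nbrs_iff)
      show "u \<in> B \<union> S"
      proof (cases "u = b")
        case False
        then have "{v, u} \<in> ?E'" using kept[OF u] v rB neq by blast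
        then show ?thesis using cut_no_edge[OF cut_sym[OF c(1)] v(1)] inV[of u] u edgeD by blast
      qed (use b in simp)
    qed
  qed
  have caseII: "d + card (nbrs E s \<inter> W) \<le> 2 * card M + k + t"
    if c: "cut V ?E' A S B" "card S < k" "s \<in> A" "b \<in> B" for A S B
  proof (rule augmentation_count[OF ex(1) c(1,2) _ c(4) neq(3) _ t low])
    have inV: "v \<in> A \<union> S \<union> B" if "v \<in> V" for v using c(1) that unfolding cut_def by simp
    have "{b, a} \<in> ?E'" using ab' by (simp add: insert_commute)
    then have "a \<notin> A" using cut_no_edge[OF cut_sym[OF c(1)] c(4)] by blast
    then have a: "a \<in> B \<union> S" using inV neq W_subset by blast
    have sB: "s \<notin> B" using c(1,3) unfolding cut_def by blast
    show "nbrs E s \<subseteq> A \<union> S \<union> {b}"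
    proof
      fix v assume "v \<in> nbrs E s"
      then have v: "{s, v} \<in> E" by (simp add: nbrs_iff)
      show "v \<in> A \<union> S \<union> {b}"
      proof (cases "v = b")
        case False
        then have "{s, v} \<in> ?E'" using kept[OF v] rs neq by blast
        then show ?thesis using cut_no_edge[OF c(1,3)] inV[of v] v edgeD by blast
      qed simp
    qed
    fix v assume v: "v \<in> B" "v \<in> R"
    show "nbrs E v \<subseteq> B \<union> S"
    proof
      fix u assume "u \<in> nbrs E v"
      then have u: "{v, u} \<in> E" by (simp add: nbrs_iff)
      show "u \<in> B \<union> S"
      proof (cases "u = a")
        case False
        then have "{v, u} \<in> ?E'" using kept[OF u] v sB neq by blast
        then show ?thesis using cut_no_edge[OF cut_sym[OF c(1)] v(1)] inV[of u] u edgeD by blast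
      qed (use a in simp)
    qed
  qed
  obtain A S B where c: "cut V ?E' A S B" "card S < k" using ex(2) by blast
  have "\<exists>p\<in>A. \<exists>q\<in>B. {p, q} \<in> E"
  proof (rule ccontr)
    assume "\<not> ?thesis"
    then have "\<forall>p\<in>A. \<forall>q\<in>B. {p, q} \<notin> E" by blast
    with c(1) have "cut V E A S B" unfolding cut_def by simp
    then show False using kcon_M c(2) unfolding kcon_def by fastforce
  qed
  then obtain p q where pq: "p \<in> A" "q \<in> B" "{p, q} \<in> E" by blast
  then have "{p, q} \<notin> ?E'" using cut_no_edge[OF c(1)] by blast
  then have "{p, q} = {r, a} \<or> {p, q} = {s, b}" using ex(4)[OF pq(3)] by blast
  then consider "p = r" "q = a" | "p = a" "q = r" | "p = s" "q = b" | "p = b" "q = s"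
    by (auto simp: doubleton_eq_iff)
  then show ?thesis
  proof cases
    case 1 then show ?thesis using caseI[OF c] pq by blast
  next
    case 2 then show ?thesis using caseI[OF cut_sym[OF c(1)] c(2)] pq by blast
  next
    case 3 then show ?thesis using caseII[OF c] pq by blast
  next
    case 4 then show ?thesis using caseII[OF cut_sym[OF c(1)] c(2)] pq by blast
  qed
qed

text \<open>The degree parameter \<open>t\<close> is 1 when \<open>R\<close> induces a forest and 0 when \<open>R\<close> is independent; the sharper
second case is what the connected case below needs.\<close>

lemma stuck_bound:
  assumes rs: "r \<in> R" "s \<in> R" "r \<noteq> s"
    and deg: "card (nbrs E r \<inter> R) \<le> t" "card (nbrs E s \<inter> R) \<le> t"
    and many: "2 * card M + 2 * t < 2 * d"
    and t: "t \<le> 1" and low: "\<And>X. X \<subseteq> R \<Longrightarrow> X \<noteq> {} \<Longrightarrow> \<exists>v\<in>X. card (nbrs E v \<inter> X) \<le> t"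
  shows "2 * d \<le> 2 * card M + k + 2 * t"
proof -
  have r: "d \<le> card (nbrs E r \<inter> W) + t" and s: "d \<le> card (nbrs E s \<inter> W) + t"
    using deg_R[OF rs(1)] deg_R[OF rs(2)] card_nbrs_split[of r] card_nbrs_split[of s] deg by linarith+
  then have "card W < card (nbrs E r \<inter> W) + card (nbrs E s \<inter> W)" using many card_W by linarith
  then obtain a b where ab: "{a, b} \<in> M"
    and *: "a \<in> nbrs E r \<and> b \<in> nbrs E r \<and> b \<in> nbrs E s \<or> a \<in> nbrs E s \<and> b \<in> nbrs E s \<and> b \<in> nbrs E r"
    using crowded_matching_edge by blast
  from * show ?thesis
  proof
    assume "a \<in> nbrs E r \<and> b \<in> nbrs E r \<and> b \<in> nbrs E s"
    then show ?thesis
      using failed_exchange_bound[OF ab rs _ _ _ t low] r s by (auto simp: nbrs_iff)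
  next
    assume "a \<in> nbrs E s \<and> b \<in> nbrs E s \<and> b \<in> nbrs E r"
    then show ?thesis
      using failed_exchange_bound[OF ab rs(2,1) rs(3)[symmetric] _ _ _ t low] r s by (auto simp: nbrs_iff)
  qed
qed

text \<open>A smaller matching would miss at least two vertices, so the forest on \<open>R\<close> would have two low vertices, to which
the exchange bound applies with \<open>t = 1\<close>.\<close>

lemma stuck_matching_size:
  assumes "2 * d \<le> card V"
  shows "2 * d \<le> 2 * card M + k + 2"
proof (rule ccontr)
  assume contra: "\<not> ?thesis"
  then have "2 \<le> card R" using assms card_R by linarith
  then obtain r s where "r \<in> R" "s \<in> R" "r \<noteq> s" "card (nbrs E r \<inter> R) \<le> 1" "card (nbrs E s \<inter> R) \<le> 1"
    using two_low_vertices[of R] by blast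
  from stuck_bound[OF this _ _ low_vertex] contra assms show False by linarith
qed

section \<open>Two boundary cases\<close>

text \<open>Here \<open>M\<close> is a single edge \<open>xy\<close>. Two low vertices \<open>u\<close> and \<open>v\<close> of the forest on \<open>R\<close> have degree at
least 3 and hence are adjacent to both \<open>x\<close> and \<open>y\<close>. Trading \<open>xy\<close> for \<open>ux\<close> and \<open>vy\<close> works: since \<open>xy\<close>
is back, a cut by at most one vertex has a side \<open>B\<close> inside \<open>R\<close>; the low vertices of the forest
on \<open>B\<close> have too few neighbours unless they are \<open>u\<close> or \<open>v\<close>, and these still see \<open>y\<close> or \<open>x\<close>.\<close>

lemma not_stuck_2_3:
  assumes k: "k = 2" and d: "d = 3" and M: "card M = 1" and V: "2 * d \<le> card V"
  shows False
proof -
  obtain e0 where e0: "M = {e0}" using M by (auto simp: card_1_singleton_iff)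
  then have "card e0 = 2" using M_edges edges by blast
  then obtain x y where xy: "e0 = {x, y}" "x \<noteq> y" by (auto simp: card_2_iff)
  have W: "W = {x, y}" and xyM: "{x, y} \<in> M" using e0 xy by auto
  have "2 \<le> card R" using card_R V d M by simp
  then obtain u v where uv: "u \<in> R" "v \<in> R" "u \<noteq> v"
    and low: "card (nbrs E u \<inter> R) \<le> 1" "card (nbrs E v \<inter> R) \<le> 1"
    using two_low_vertices[of R] by blast
  have full: "x \<in> nbrs E z \<and> y \<in> nbrs E z" if "z \<in> R" "card (nbrs E z \<inter> R) \<le> 1" for z
  proof -
    have "2 \<le> card (nbrs E z \<inter> W)"
      using deg_R[OF that(1)] card_nbrs_split[of z] that(2) d by linarith
    moreover have "card W = 2" using card_W M by simp
    ultimately have "nbrs E z \<inter> W = W" using finite_W by (intro card_seteq) auto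
    then show ?thesis using W by blast
  qed
  have e: "{u, x} \<in> E" "{u, y} \<in> E" "{v, x} \<in> E" "{v, y} \<in> E"
    using full[OF uv(1) low(1)] full[OF uv(2) low(2)] by (auto simp only: nbrs_iff)
  let ?E' = "E0 - exchange x y u v"
  note ex = exchange_fails[OF xyM uv e(1,4)]
  have neq: "u \<notin> {x, y}" "v \<notin> {x, y}" using uv W by blast+
  have kept: "{u, y} \<in> ?E'" "{v, x} \<in> ?E'"
    using ex(4)[OF e(2)] ex(4)[OF e(3)] neq uv(3) xy(2) by (auto simp: doubleton_eq_iff)
  have impossible: False if c: "cut V ?E' A S B" "card S < k" and B: "B \<inter> W = {}" for A S B
  proof -
    have parts: "A \<union> S \<union> B = V" "A \<inter> S = {}" "A \<inter> B = {}" "S \<inter> B = {}" "B \<noteq> {}"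
      using c(1) unfolding cut_def by auto
    have "finite (A \<union> S \<union> B)" using finite_V parts(1) by simp
    then have fins: "finite S" "finite B" by simp_all
    have BR: "B \<subseteq> R" using B parts(1) by blast
    have S1: "card S \<le> 1" using c(2) k by simp
    have nbr: "q \<in> B \<union> S" if "p \<in> B" "{p, q} \<in> ?E'" for p q
      using cut_no_edge[OF cut_sym[OF c(1)] that] that(2) edgeD parts(1) by blast
    have special: "z = u \<or> z = v" if z: "z \<in> B" "card (nbrs E z \<inter> B) \<le> 1" for z
    proof (rule ccontr)
      assume other: "\<not> ?thesis"
      have "nbrs E z \<subseteq> (nbrs E z \<inter> B) \<union> S"
      proof
        fix q assume "q \<in> nbrs E z"
        then have q: "{z, q} \<in> E" by (simp add: nbrs_iff)
        then have "{z, q} \<in> ?E'"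
          using ex(4)[OF q] other z(1) B W by (auto simp: doubleton_eq_iff)
        then show "q \<in> (nbrs E z \<inter> B) \<union> S" using nbr[OF z(1)] q by (auto simp: nbrs_iff)
      qed
      then have "card (nbrs E z) \<le> card ((nbrs E z \<inter> B) \<union> S)"
        using fins by (intro card_mono) auto
      also have "\<dots> \<le> card (nbrs E z \<inter> B) + card S" by (rule card_Un_le)
      finally show False using z S1 deg_R[of z] BR d by fastforce
    qed
    have uS: "y \<in> S" if "u \<in> B" using nbr[OF that kept(1)] B W by blast
    have vS: "x \<in> S" if "v \<in> B" using nbr[OF that kept(2)] B W by blast
    have notboth: "\<not> (u \<in> B \<and> v \<in> B)"
    proof
      assume "u \<in> B \<and> v \<in> B"
      then have "{x, y} \<subseteq> S" using uS vS by blast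
      then have "card {x, y} \<le> card S" using fins by (intro card_mono) auto
      then show False using xy S1 by simp
    qed
    have "\<not> 2 \<le> card B"
    proof
      assume "2 \<le> card B"
      then obtain p q where "p \<in> B" "q \<in> B" "p \<noteq> q" "card (nbrs E p \<inter> B) \<le> 1" "card (nbrs E q \<inter> B) \<le> 1"
        using two_low_vertices[OF BR] by blast
      then show False using special notboth by blast
    qed
    moreover have "card B \<noteq> 0" using parts(5) fins by simp
    ultimately have "card B = 1" by linarith
    then obtain z where z: "B = {z}" by (auto simp: card_1_singleton_iff)
    have "nbrs ?E' z \<subseteq> S"
    proof
      fix q assume "q \<in> nbrs ?E' z"
      then have q: "{z, q} \<in> ?E'" by (simp add: nbrs_iff)
      then have "q \<noteq> z" using edgeD by blast
      then show "q \<in> S" using nbr[OF _ q] z by blast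
    qed
    then have "card (nbrs ?E' z) \<le> card S" by (rule card_mono[OF fins(1)])
    then have "card (nbrs ?E' z) \<le> 1" using S1 by linarith
    moreover have "z \<in> V" using z BR by blast
    ultimately show False
      using card_nbrs_delete_matching[OF finite_V edges ex(1), of z] min_deg[of z] d by linarith
  qed
  obtain A S B where c: "cut V ?E' A S B" "card S < k" using ex(2) by blast
  have xyE': "y \<notin> B" if "x \<in> A" using cut_no_edge[OF c(1) that ex(3)] .
  have xyE'': "y \<notin> A" if "x \<in> B" using cut_no_edge[OF cut_sym[OF c(1)] that ex(3)] .
  have "A \<inter> B = {}" using c(1) unfolding cut_def by blast
  then have "A \<inter> W = {} \<or> B \<inter> W = {}" using xyE' xyE'' unfolding W by blast
  then show False using impossible[OF c] impossible[OF cut_sym[OF c(1)] c(2)] by blast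
qed

lemma cut_1_partition:
  assumes "cut V F A S B" "card S < 1"
  shows "S = {}" "A \<union> B = V" "A \<inter> B = {}"
proof -
  have "A \<union> S \<union> B = V" using assms unfolding cut_def by simp
  then have "finite (A \<union> S \<union> B)" using finite_V by simp
  then have "finite S" by simp
  then show S: "S = {}" using assms(2) by simp
  show "A \<union> B = V" "A \<inter> B = {}" using assms(1) unfolding cut_def S by auto
qed

text \<open>If \<open>R\<close> is independent, the sharper form of the exchange bound suffices. Otherwise take a vertex
\<open>r\<close> with exactly one neighbour \<open>r'\<close> in \<open>R\<close>. The edge \<open>rr'\<close> is a bridge, with sides \<open>A\<close> and \<open>B\<close>. Both
\<open>r\<close> and a low vertex \<open>w\<close> of \<open>B \<inter> R\<close> have \<open>d - 1\<close> neighbours in \<open>W\<close>, all on their own side, and \<open>W\<close>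
has only \<open>2 * (d - 1)\<close> elements; so \<open>r\<close> is adjacent to all of \<open>W \<inter> A\<close> and \<open>w\<close> to all of \<open>W \<inter> B\<close>.

A matching edge \<open>ab\<close> between \<open>A\<close> and \<open>B\<close> can be traded for \<open>ra\<close> and \<open>wb\<close>: the sides are joined by \<open>ab\<close> and
by \<open>rr'\<close>, and neither falls apart. If there is no such edge, \<open>M\<close> matches \<open>W \<inter> A\<close> within itself.
Then either another low vertex \<open>u\<close> of \<open>A \<inter> R\<close> is adjacent to all of \<open>W \<inter> A\<close>, and any \<open>ab\<close> there can be
traded for \<open>ra\<close> and \<open>ub\<close>, or \<open>A\<close> has only \<open>d\<close> vertices, too few for a vertex of \<open>W \<inter> A\<close>: its
\<open>d - 1\<close> remaining neighbours are among the vertices of \<open>A\<close> other than itself and its partner in \<open>M\<close>.\<close>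

lemma not_stuck_1:
  assumes k: "k = 1" and d: "3 \<le> d" and M: "card M + 1 = d" and V: "2 * d \<le> card V"
  shows False
proof (cases "\<forall>v\<in>R. nbrs E v \<inter> R = {}")
  case True
  have "2 \<le> card R" using card_R V M by simp
  then obtain r s where "r \<in> R" "s \<in> R" "r \<noteq> s" using two_low_vertices[of R] by blast
  moreover have "\<exists>v\<in>X. card (nbrs E v \<inter> X) \<le> 0" if X: "X \<subseteq> R" "X \<noteq> {}" for X
  proof -
    obtain v where "v \<in> X" using X(2) by blast
    moreover from this have "nbrs E v \<inter> X = {}" using X(1) True by blast
    ultimately show ?thesis by (metis card.empty le_refl)
  qed
  ultimately have "2 * d \<le> 2 * card M + k + 2 * 0"
    using True M by (intro stuck_bound[of r s 0]) auto
  then show False using M k by simp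
next
  case False
  \<comment> \<open>Isolated vertices of the forest are discarded first, so that the low vertex found has
    exactly one neighbour in R.\<close>
  define X where "X = {v \<in> R. nbrs E v \<inter> R \<noteq> {}}"
  have "X \<subseteq> R" "X \<noteq> {}" using False by (auto simp: X_def)
  then obtain r where r: "r \<in> X" "card (nbrs E r \<inter> X) \<le> 1" using low_vertex by blast
  then obtain r' where r': "r' \<in> nbrs E r" "r' \<in> R" unfolding X_def by blast
  have "nbrs E r \<inter> R \<subseteq> nbrs E r \<inter> X"
    using r(1) nbrs_sym[of r E] unfolding X_def by blast
  then have "card (nbrs E r \<inter> R) \<le> 1"
    using r(2) card_mono[of "nbrs E r \<inter> X" "nbrs E r \<inter> R"] finite_nbrs by fastforce
  then have only: "nbrs E r \<inter> R = {r'}"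
    using r' finite_nbrs card_le_Suc0_iff_eq[of "nbrs E r \<inter> R"] by auto
  have rR: "r \<in> R" using r by (simp add: X_def)
  have rr': "{r, r'} \<in> E" using r' by (simp add: nbrs_iff)
  obtain A0 S0 B0 where c0: "cut V (E - {{r, r'}}) A0 S0 B0" "card S0 < 1"
    using R_edge_critical[OF rR r'(2) rr'] k unfolding kcon_def by (auto simp: not_le)
  have "\<exists>A B. cut V (E - {{r, r'}}) A {} B \<and> r \<in> A \<and> r' \<in> B"
  proof -
    have S0: "S0 = {}" using cut_1_partition[OF c0] by blast
    have "\<exists>p\<in>A0. \<exists>q\<in>B0. {p, q} \<in> E"
    proof (rule ccontr)
      assume "\<not> ?thesis"
      then have "\<forall>p\<in>A0. \<forall>q\<in>B0. {p, q} \<notin> E" by blast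
      with c0(1) have "cut V E A0 S0 B0" unfolding cut_def by simp
      then show False using kcon_M c0(2) k unfolding kcon_def by fastforce
    qed
    then obtain p q where pq: "p \<in> A0" "q \<in> B0" "{p, q} \<in> E" by blast
    then have "{p, q} = {r, r'}" using cut_no_edge[OF c0(1)] by blast
    then consider "p = r" "q = r'" | "p = r'" "q = r" by (auto simp: doubleton_eq_iff)
    then show ?thesis
    proof cases
      case 1 then show ?thesis using pq c0(1) S0 by blast
    next
      case 2 then show ?thesis using pq cut_sym[OF c0(1)] S0 by blast
    qed
  qed
  then obtain A B where c: "cut V (E - {{r, r'}}) A {} B" and rA: "r \<in> A" and r'B: "r' \<in> B" by blast
  have AB: "A \<union> B = V" "A \<inter> B = {}" using cut_1_partition[OF c] by auto
  have stayA: "q \<in> A" if "p \<in> A" "{p, q} \<in> E" "p \<noteq> r \<or> q \<noteq> r'" for p q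
  proof -
    have "{p, q} \<noteq> {r, r'}" using that rA r'B AB(2) by (auto simp: doubleton_eq_iff)
    then have "q \<notin> B" using cut_no_edge[OF c that(1)] that(2) by blast
    then show ?thesis using AB(1) edgeD that(2) by blast
  qed
  have stayB: "q \<in> B" if "p \<in> B" "{p, q} \<in> E" "p \<noteq> r' \<or> q \<noteq> r" for p q
  proof -
    have "{p, q} \<noteq> {r, r'}" using that rA r'B AB(2) by (auto simp: doubleton_eq_iff)
    then have "q \<notin> A" using cut_no_edge[OF cut_sym[OF c] that(1)] that(2) by blast
    then show ?thesis using AB(1) edgeD that(2) by blast
  qed
  have r_W: "d \<le> card (nbrs E r \<inter> W) + 1"
    using deg_R[OF rR] card_nbrs_split[of r] only by simp
  have r_WA: "nbrs E r \<inter> W \<subseteq> W \<inter> A"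
  proof
    fix q assume q: "q \<in> nbrs E r \<inter> W"
    then have "q \<noteq> r'" "{r, q} \<in> E" using r'(2) by (blast, simp add: nbrs_iff)
    then have "q \<in> A" using stayA[OF rA] by blast
    then show "q \<in> W \<inter> A" using q by blast
  qed
  \<comment> \<open>The end r' of the bridge has one more neighbour in R than its degree within B shows, so it
    is chosen only if nothing else is available.\<close>
  have "\<exists>w\<in>B \<inter> R. (w = r' \<longrightarrow> B \<inter> R = {r'}) \<and> card (nbrs E w \<inter> R) \<le> 1"
  proof (cases "B \<inter> R = {r'}")
    case True
    have "nbrs E r' \<inter> R \<subseteq> {r}"
    proof
      fix q assume q: "q \<in> nbrs E r' \<inter> R"
      show "q \<in> {r}"
      proof (rule ccontr)
        assume "q \<notin> {r}"
        then have "q \<in> B" using stayB[OF r'B, of q] q by (auto simp: nbrs_iff)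
        then have "q = r'" using q True by blast
        then show False using q nbrs_E_subset[of r'] by blast
      qed
    qed
    then show ?thesis using True card_mono[of "{r}"] by fastforce
  next
    case False
    have "\<not> card (B \<inter> R) \<le> 1"
    proof
      assume "card (B \<inter> R) \<le> 1"
      then have "B \<inter> R \<subseteq> {r'}" using r'B r'(2) finite_V card_le_Suc0_iff_eq[of "B \<inter> R"] by auto
      then show False using False r'B r'(2) by blast
    qed
    then obtain w where w: "w \<in> B \<inter> R" "w \<noteq> r'" "card (nbrs E w \<inter> (B \<inter> R)) \<le> 1"
      using low_vertex_avoiding[of "B \<inter> R" r'] by force
    have "nbrs E w \<inter> R \<subseteq> nbrs E w \<inter> (B \<inter> R)"
      using stayB[of w] w by (auto simp: nbrs_iff)
    then have "card (nbrs E w \<inter> R) \<le> card (nbrs E w \<inter> (B \<inter> R))"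
      by (rule card_mono[rotated]) (simp add: finite_nbrs)
    then show ?thesis using w by (meson order_trans)
  qed
  then obtain w where w: "w \<in> B" "w \<in> R" "w = r' \<Longrightarrow> B \<inter> R = {r'}" "card (nbrs E w \<inter> R) \<le> 1"
    by blast
  have w_W: "d \<le> card (nbrs E w \<inter> W) + 1"
    using deg_R[OF w(2)] card_nbrs_split[of w] w(4) by simp
  have w_WB: "nbrs E w \<inter> W \<subseteq> W \<inter> B"
  proof
    fix q assume q: "q \<in> nbrs E w \<inter> W"
    then have "q \<noteq> r" "{w, q} \<in> E" using rR by (blast, simp add: nbrs_iff)
    then have "q \<in> B" using stayB[OF w(1)] by blast
    then show "q \<in> W \<inter> B" using q by blast
  qed
  have rw: "r \<noteq> w" using rA w(1) AB(2) by blast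
  have cW: "card (W \<inter> A) + card (W \<inter> B) + 2 = 2 * d"
  proof -
    have "W \<inter> A \<union> W \<inter> B = W" using AB(1) W_subset by blast
    moreover have "card (W \<inter> A \<union> W \<inter> B) = card (W \<inter> A) + card (W \<inter> B)"
      using finite_W AB(2) by (intro card_Un_disjoint) auto
    ultimately show ?thesis using card_W M by simp
  qed
  have cA: "card (nbrs E r \<inter> W) \<le> card (W \<inter> A)" using r_WA finite_W by (intro card_mono) auto
  have cB: "card (nbrs E w \<inter> W) \<le> card (W \<inter> B)" using w_WB finite_W by (intro card_mono) auto
  have WA: "nbrs E r \<inter> W = W \<inter> A"
    using r_WA finite_W cA cB cW r_W w_W by (intro card_seteq) auto
  have WB: "nbrs E w \<inter> W = W \<inter> B"
    using w_WB finite_W cA cB cW r_W w_W by (intro card_seteq) auto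
  have cWA: "card (W \<inter> A) + 1 = d" using cA cB cW r_W w_W by linarith
  show False
  proof (cases "\<exists>a b. {a, b} \<in> M \<and> a \<in> A \<and> b \<in> B")
    case True
    then obtain a b where ab: "{a, b} \<in> M" "a \<in> A" "b \<in> B" by blast
    then have abW: "a \<in> W" "b \<in> W" by auto
    have ra: "{r, a} \<in> E" using WA ab(2) abW by (auto simp: nbrs_iff)
    have wb: "{w, b} \<in> E" using WB ab(3) abW by (auto simp: nbrs_iff)
    let ?E' = "E0 - exchange a b r w"
    note ex = exchange_fails[OF ab(1) rR w(2) rw ra wb]
    have kept: "{p, q} \<in> ?E'" if "{p, q} \<in> E" "p = r \<Longrightarrow> q \<noteq> a" "q = r \<Longrightarrow> p \<noteq> a"
      "p = w \<Longrightarrow> q \<noteq> b" "q = w \<Longrightarrow> p \<noteq> b" for p q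
      using ex(4)[OF that(1)] that by (auto simp: doubleton_eq_iff)
    have impossible: False if cc: "cut V ?E' C S D" "card S < k" and rC: "r \<in> C" for C S D
    proof -
      have CD: "C \<union> D = V" "C \<inter> D = {}" "D \<noteq> {}"
        using cut_1_partition[of ?E' C S D] cc k unfolding cut_def by auto
      have closedC: "q \<in> C" if "p \<in> C" "{p, q} \<in> ?E'" for p q
        using cut_no_edge[OF cc(1) that] that(2) edgeD CD(1) by blast
      have closedD: "q \<in> D" if "p \<in> D" "{p, q} \<in> ?E'" for p q
        using cut_no_edge[OF cut_sym[OF cc(1)] that] that(2) edgeD CD(1) by blast
      have r'C: "r' \<in> C" using closedC[OF rC kept[OF rr']] abW rR r'(2) rw by blast
      have WC: "q \<in> C" if "q \<in> W" "q \<in> A" "q \<noteq> a" for q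
      proof -
        have "{r, q} \<in> E" using WA that by (auto simp: nbrs_iff)
        from closedC[OF rC kept[OF this]] show ?thesis using that rR w(2) rw abW by blast
      qed
      have few: "card (nbrs E p) \<le> card (nbrs E p \<inter> Y) + 1" if "nbrs E p \<subseteq> Y \<union> {z}" for p Y z
      proof -
        have "card (nbrs E p) \<le> card ((nbrs E p \<inter> Y) \<union> {z})"
          using that finite_nbrs by (intro card_mono) auto
        also have "\<dots> \<le> card (nbrs E p \<inter> Y) + 1"
          by (rule order_trans[OF card_Un_le]) simp
        finally show ?thesis .
      qed
      \<comment> \<open>A low vertex on this part would see at most a and one vertex of R, and a alone would
        see only r.\<close>
      have DA: "D \<inter> A = {}"
      proof (rule ccontr)
        assume ne: "D \<inter> A \<noteq> {}"
        have stay: "q \<in> D \<inter> A" if p: "p \<in> D" "p \<in> A" and e: "{p, q} \<in> E" and n: "p = a \<Longrightarrow> q \<noteq> r" for p q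
        proof -
          have "p \<noteq> r" using p rC CD(2) by blast
          moreover from this have "q \<in> A" using stayA[OF p(2) e] by blast
          ultimately have "{p, q} \<in> ?E'" using kept[OF e] n p(2) w(1) AB(2) by blast
          then show ?thesis using closedD[OF p(1)] \<open>q \<in> A\<close> by blast
        qed
        show False
        proof (cases "D \<inter> A \<inter> R = {}")
          case True
          then have "D \<inter> A \<subseteq> {a}" using WC CD AB(1) by blast
          then have DA: "D \<inter> A = {a}" using ne by blast
          have "nbrs E a \<subseteq> {r}"
          proof
            fix q assume "q \<in> nbrs E a"
            then have q: "{a, q} \<in> E" by (simp add: nbrs_iff)
            show "q \<in> {r}"
            proof (rule ccontr)
              assume "q \<notin> {r}"
              then have "q \<in> D \<inter> A" using stay[OF _ _ q] DA by blast
              then have "q = a" using DA by blast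
              then show False using edgeD[of a q] q by blast
            qed
          qed
          then have "card (nbrs E a) \<le> 1" using card_mono[of "{r}"] by fastforce
          then show False using deg_E[of a] abW W_subset d by fastforce
        next
          case False
          then obtain p where p: "p \<in> D \<inter> A \<inter> R" "card (nbrs E p \<inter> (D \<inter> A \<inter> R)) \<le> 1"
            using low_vertex[of "D \<inter> A \<inter> R"] by blast
          have "nbrs E p \<subseteq> (D \<inter> A \<inter> R) \<union> {a}"
          proof
            fix q assume "q \<in> nbrs E p"
            then have q: "{p, q} \<in> E" by (simp add: nbrs_iff)
            have "p \<noteq> a" using p abW by blast
            then have "q \<in> D \<inter> A" using stay[OF _ _ q] p by blast
            then show "q \<in> (D \<inter> A \<inter> R) \<union> {a}" using WC[of q] CD AB(1) by blast
          qed
          then have "card (nbrs E p) \<le> 2" using few[of p "D \<inter> A \<inter> R" a] p(2) by linarith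
          moreover have "p \<in> R" using p(1) by blast
          ultimately show False using deg_R[of p] d by linarith
        qed
      qed
      then have aC: "a \<in> C" using ab(2) AB CD by blast
      have bC: "b \<in> C" using closedC[OF aC ex(3)] .
      \<comment> \<open>If w is on the side of r, so is all of W, and D lies in R. If not, the part of B on
        the side of r contains r' but no vertex of W other than b. Each time a low vertex has
        too few neighbours.\<close>
      show False
      proof (cases "w \<in> C")
        case True
        have WC': "q \<in> C" if "q \<in> W" "q \<in> B" for q
        proof (cases "q = b")
          case False
          have "{w, q} \<in> E" using WB that by (auto simp: nbrs_iff)
          from closedC[OF True kept[OF this]] show ?thesis using that rR w(2) rw abW False by blast
        qed (use bC in simp)
        have "D \<subseteq> R" "D \<subseteq> B" using DA WC' CD AB by blast+
        then obtain p where p: "p \<in> D" "card (nbrs E p \<inter> D) \<le> 1"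
          using low_vertex[of D] CD by blast
        have "nbrs E p \<subseteq> nbrs E p \<inter> D"
        proof
          fix q assume "q \<in> nbrs E p"
          then have q: "{p, q} \<in> E" by (simp add: nbrs_iff)
          have "p \<noteq> r" "p \<noteq> w" "p \<noteq> a" "p \<noteq> b" using p(1) rC True aC bC CD(2) by blast+
          then have "q \<in> D" using closedD[OF p(1) kept[OF q]] by blast
          then show "q \<in> nbrs E p \<inter> D" using \<open>q \<in> nbrs E p\<close> by blast
        qed
        then have "card (nbrs E p) \<le> 1"
          using card_mono[of "nbrs E p \<inter> D" "nbrs E p"] finite_nbrs p(2) by fastforce
        then show False using deg_R[of p] p(1) \<open>D \<subseteq> R\<close> d by fastforce
      next
        case False
        then have wD: "w \<in> D" using w(1) AB(1) CD(1) by blast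
        then have wr': "w \<noteq> r'" using r'C CD(2) by blast
        have WD: "q \<in> D" if "q \<in> W" "q \<in> B" "q \<noteq> b" for q
        proof -
          have "{w, q} \<in> E" using WB that by (auto simp: nbrs_iff)
          from closedD[OF wD kept[OF this]] show ?thesis using that rR w(2) rw abW by blast
        qed
        let ?Y = "C \<inter> B \<inter> R"
        have stay: "q \<in> ?Y \<union> {b}" if p: "p \<in> ?Y" and e: "{p, q} \<in> E" and n: "p = r' \<Longrightarrow> q \<noteq> r" for p q
        proof -
          have qB: "q \<in> B" using stayB[OF _ e] p n by blast
          have "p \<noteq> w" "p \<noteq> r" "p \<noteq> b" "p \<noteq> a" "q \<noteq> r" "q \<noteq> a"
            using p wD CD(2) rA AB(2) qB abW ab(2) by blast+
          then have "{p, q} \<in> ?E'" using kept[OF e] by blast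
          then have "q \<in> C" using closedC p by blast
          then show ?thesis using WD[of q] qB CD(2) edgeD e by blast
        qed
        show False
        proof (cases "?Y = {r'}")
          case True
          have "nbrs E r' \<subseteq> {r, b}"
          proof
            fix q assume "q \<in> nbrs E r'"
            then have q: "{r', q} \<in> E" by (simp add: nbrs_iff)
            show "q \<in> {r, b}"
            proof (rule ccontr)
              assume "q \<notin> {r, b}"
              then have "q \<in> ?Y" using stay[OF _ q] True by blast
              then have "q = r'" using True by blast
              then show False using edgeD[of r' q] q by blast
            qed
          qed
          then have "card (nbrs E r') \<le> card {r, b}" by (intro card_mono) auto
          also have "\<dots> \<le> 2" by (simp add: card_insert_if)
          finally show False using deg_R[OF r'(2)] d by linarith
        next
          case False
          have "\<not> card ?Y \<le> 1"
          proof
            assume "card ?Y \<le> 1"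
            then have "?Y \<subseteq> {r'}"
              using r'B r'(2) r'C finite_V card_le_Suc0_iff_eq[of ?Y] by auto
            then show False using False r'B r'(2) r'C by blast
          qed
          then obtain p where p: "p \<in> ?Y" "p \<noteq> r'" "card (nbrs E p \<inter> ?Y) \<le> 1"
            using low_vertex_avoiding[of ?Y r'] by force
          have "nbrs E p \<subseteq> ?Y \<union> {b}"
          proof
            fix q assume "q \<in> nbrs E p"
            then show "q \<in> ?Y \<union> {b}" using stay[OF p(1), of q] p(2) unfolding nbrs_iff by blast
          qed
          then have "card (nbrs E p) \<le> 2" using few[of p ?Y b] p(3) by linarith
          moreover have "p \<in> R" using p(1) by blast
          ultimately show False using deg_R[of p] d by linarith
        qed
      qed
    qed
    obtain C S D where cc: "cut V ?E' C S D" "card S < k" using ex(2) by blast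
    then have "r \<in> C \<or> r \<in> D" using cut_1_partition(2)[of ?E' C S D] rR k by blast
    then show False using impossible[OF cc] impossible[OF cut_sym[OF cc(1)] cc(2)] by blast
  next
    case False
    have "card (W \<inter> A) \<noteq> 0" using cWA d by linarith
    then have "W \<inter> A \<noteq> {}" by (metis card.empty)
    then obtain a where a: "a \<in> W" "a \<in> A" by blast
    then obtain e where "e \<in> M" "a \<in> e" by blast
    moreover from this have "card e = 2" using M_edges edges by blast
    then obtain p q where "e = {p, q}" by (auto simp: card_2_iff)
    ultimately have "e = {a, q} \<or> e = {a, p}" by (auto simp: insert_commute)
    then obtain b where ab: "{a, b} \<in> M" using \<open>e \<in> M\<close> by blast
    have b: "b \<in> W" "b \<in> A" "a \<noteq> b" using ab False a AB(1) W_subset M_edges edgeD by blast+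
    have raE: "{r, a} \<in> E" "{r, b} \<in> E" using WA a b by (auto simp: nbrs_iff)
    show False
    proof (cases "A \<inter> R = {r}")
      case True
      then have A: "A = insert r (W \<inter> A)" using AB(1) by blast
      have "nbrs E a \<subseteq> A - {a, b}"
      proof
        fix q assume "q \<in> nbrs E a"
        then have q: "{a, q} \<in> E" by (simp add: nbrs_iff)
        have "a \<noteq> r" using a rR by blast
        then have "q \<in> A" using stayA[OF a(2) q] by blast
        then show "q \<in> A - {a, b}" using q ab edgeD by blast
      qed
      moreover have "finite A" using AB(1) finite_V by (metis finite_Un)
      ultimately have "card (nbrs E a) \<le> card (A - {a, b})" by (intro card_mono) auto
      also have "\<dots> = card A - 2" using \<open>finite A\<close> a b by (subst card_Diff_subset) auto
      also have "card A = d"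
        using A cWA rR finite_W by (metis Int_iff DiffD2 Suc_eq_plus1 card_insert_disjoint finite_Int)
      finally show False using deg_E[of a] a W_subset d by fastforce
    next
      case False
      have "\<not> card (A \<inter> R) \<le> 1"
      proof
        assume "card (A \<inter> R) \<le> 1"
        then have "A \<inter> R \<subseteq> {r}" using rA rR finite_V card_le_Suc0_iff_eq[of "A \<inter> R"] by auto
        then show False using False rA rR by blast
      qed
      then obtain u where u: "u \<in> A \<inter> R" "u \<noteq> r" "card (nbrs E u \<inter> (A \<inter> R)) \<le> 1"
        using low_vertex_avoiding[of "A \<inter> R" r] by force
      have uA: "nbrs E u \<subseteq> A" using stayA[of u] u by (auto simp: nbrs_iff)
      have "nbrs E u \<inter> R \<subseteq> nbrs E u \<inter> (A \<inter> R)" using uA by blast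
      then have "card (nbrs E u \<inter> R) \<le> card (nbrs E u \<inter> (A \<inter> R))"
        by (rule card_mono[rotated]) (simp add: finite_nbrs)
      then have "d \<le> card (nbrs E u \<inter> W) + 1"
        using deg_R[of u] card_nbrs_split[of u] u by simp
      then have "nbrs E u \<inter> W = W \<inter> A"
        using uA finite_W cWA by (intro card_seteq) auto
      then have uE: "{u, a} \<in> E" "{u, b} \<in> E" using a b by (auto simp: nbrs_iff)
      have uR: "u \<in> R" using u by blast
      let ?E' = "E0 - exchange a b r u"
      note ex = exchange_fails[OF ab rR uR u(2)[symmetric] raE(1) uE(2)]
      have ker: "{r, b} \<in> ?E'" "{u, a} \<in> ?E'"
        using ex(4)[OF raE(2)] ex(4)[OF uE(1)] u(2) rR uR a b by (auto simp: doubleton_eq_iff)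
      obtain C S D where cc: "cut V ?E' C S D" "card S < k" using ex(2) by blast
      have CD: "C \<union> D = V" "C \<inter> D = {}" using cut_1_partition[of ?E' C S D] cc k by auto
      have same: "p \<in> C \<longleftrightarrow> q \<in> C" if "{p, q} \<in> ?E'" for p q
        using cut_no_edge[OF cc(1) _ that] cut_no_edge[OF cut_sym[OF cc(1)] _ that]
          edgeD that CD by blast
      have "r \<in> C \<longleftrightarrow> a \<in> C" "u \<in> C \<longleftrightarrow> b \<in> C" using same[OF ker(1)] same[OF ker(2)] same[OF ex(3)] by blast+
      then have "q \<notin> D" if "p \<in> C" "{p, q} \<in> E" for p q
      proof (cases "{p, q} \<in> ?E'")
        case True
        then show ?thesis using same[OF True] that CD(2) by blast
      next
        case False
        then have "{p, q} = {r, a} \<or> {p, q} = {u, b}" using ex(4)[OF that(2)] by blast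
        then show ?thesis
          using \<open>r \<in> C \<longleftrightarrow> a \<in> C\<close> \<open>u \<in> C \<longleftrightarrow> b \<in> C\<close> that(1) CD(2) by (auto simp: doubleton_eq_iff)
      qed
      then have "\<forall>p\<in>C. \<forall>q\<in>D. {p, q} \<notin> E" by blast
      with cc(1) have "cut V E C S D" unfolding cut_def by simp
      then show False using kcon_M cc(2) unfolding kcon_def by fastforce
    qed
  qed
qed

end

section \<open>Matching sizes that all graphs admit\<close>

text \<open>The predicate whose greatest witness \<open>max_removable\<close> selects.\<close>

definition guaranteed :: "nat \<Rightarrow> nat \<Rightarrow> nat \<Rightarrow> bool" where
  "guaranteed k d l \<longleftrightarrow>
     (\<forall>G :: nat ugraph.
       simple_graph G \<and> k_connected k G \<and> card (verts G) \<ge> 2 * d \<and> min_degree G \<ge> d \<longrightarrow>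
       (\<exists>M. removable_matching k G M \<and> card M = l))"

lemma degree_eq_card_nbrs: "simple_graph G \<Longrightarrow> degree G v = card (nbrs (edges G) v)"
  unfolding degree_def simple_graph_def by (rule card_degree) blast

lemma min_degree_ge_iff:
  assumes "simple_graph G" "verts G \<noteq> {}"
  shows "d \<le> min_degree G \<longleftrightarrow> (\<forall>v\<in>verts G. d \<le> card (nbrs (edges G) v))"
  unfolding min_degree_def using assms by (simp add: simple_graph_def degree_eq_card_nbrs)

lemma removable_matching_iff:
  assumes G: "simple_graph G" and k: "1 \<le> k" "k < card (verts G)"
  shows "removable_matching k G M \<longleftrightarrow>
    M \<subseteq> edges G \<and> pairwise disjnt M \<and> kcon k (verts G) (edges G - M)"
proof -
  have "simple_graph (delete_edges G M)" using G by (auto simp: simple_graph_def delete_edges_def)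
  from k_connected_iff_kcon[OF this k(1)] k(2) show ?thesis
    by (auto simp: removable_matching_def matching_def delete_edges_def)
qed

text \<open>Each refutation of a stuck matching becomes one step in the size of the guaranteed matching.\<close>

lemma guaranteed_Suc:
  assumes k: "1 \<le> k" "k < d" and g: "guaranteed k d m"
    and not_stuck: "\<And>(V :: nat set) E0 M. stuck_matching V E0 M k d \<Longrightarrow> card M = m \<Longrightarrow> 2 * d \<le> card V \<Longrightarrow> False"
  shows "guaranteed k d (Suc m)"
  unfolding guaranteed_def
proof (intro allI impI, elim conjE, rule ccontr)
  fix G :: "nat ugraph"
  assume G: "simple_graph G" "k_connected k G" "2 * d \<le> card (verts G)" "d \<le> min_degree G"
    and no: "\<not> (\<exists>M. removable_matching k G M \<and> card M = Suc m)"
  have n: "k < card (verts G)" using G(3) k by linarith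
  then have "verts G \<noteq> {}" by fastforce
  note iff = removable_matching_iff[OF G(1) k(1) n]
  obtain M where M: "removable_matching k G M" "card M = m" using g G unfolding guaranteed_def by blast
  have "stuck_matching (verts G) (edges G) M k d"
  proof
    show "finite (verts G)" "\<forall>e\<in>edges G. e \<subseteq> verts G \<and> card e = 2"
      using G(1) by (auto simp: simple_graph_def)
    show "M \<subseteq> edges G" "pairwise disjnt M" "kcon k (verts G) (edges G - M)" using M iff by auto
    show "d \<le> card (nbrs (edges G) v)" if "v \<in> verts G" for v
      using min_degree_ge_iff[OF G(1) \<open>verts G \<noteq> {}\<close>] G(4) that by blast
    show "\<not> kcon k (verts G) (edges G - M')"
      if "M' \<subseteq> edges G" "pairwise disjnt M'" "card M' = Suc (card M)" for M'
      using no iff[of M'] that M(2) by auto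
  qed (use k in auto)
  then show False using not_stuck M(2) G(3) by blast
qed

lemma guaranteed_0:
  assumes "1 \<le> k" "k < d"
  shows "guaranteed k d 0"
proof -
  have "removable_matching k G {}" if "k_connected k G" for G :: "nat ugraph"
    using that by (cases G) (simp add: removable_matching_def matching_def delete_edges_def)
  then show ?thesis unfolding guaranteed_def by fastforce
qed

lemma guaranteed_general:
  assumes "1 \<le> k" "k < d" "2 * l + k + 1 \<le> 2 * d"
  shows "guaranteed k d l"
  using assms(3)
proof (induction l)
  case 0
  show ?case by (rule guaranteed_0[OF assms(1,2)])
next
  case (Suc l)
  show ?case
  proof (rule guaranteed_Suc[OF assms(1,2)])
    show "guaranteed k d l" using Suc by simp
    show False if "stuck_matching V E0 M k d" "card M = l" "2 * d \<le> card V"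
      for V :: "nat set" and E0 M
      using stuck_matching.stuck_matching_size[OF that(1,3)] that(2) Suc.prems by simp
  qed
qed

lemma guaranteed_connected:
  assumes "3 \<le> d"
  shows "guaranteed 1 d d"
proof -
  have "guaranteed 1 d (Suc (d - 1))"
  proof (rule guaranteed_Suc)
    show "guaranteed 1 d (d - 1)" by (rule guaranteed_general) (use assms in auto)
    show False if "stuck_matching V E0 M 1 d" "card M = d - 1" "2 * d \<le> card V"
      for V :: "nat set" and E0 M
      using stuck_matching.not_stuck_1[OF that(1) refl assms _ that(3)] that(2) assms by simp
  qed (use assms in auto)
  then show ?thesis using assms by simp
qed

lemma guaranteed_2_3: "guaranteed 2 3 2"
proof -
  have "guaranteed 2 3 (Suc 1)"
  proof (rule guaranteed_Suc)
    show "guaranteed 2 3 1" by (rule guaranteed_general) auto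
    show False if "stuck_matching V E0 M 2 3" "card M = 1" "2 * 3 \<le> card V"
      for V :: "nat set" and E0 M
      using stuck_matching.not_stuck_2_3[OF that(1) refl refl that(2,3)] .
  qed auto
  then show ?thesis by (simp add: numeral_2_eq_2)
qed

text \<open>The edges of a matching pick distinct vertices from any vertex cover.\<close>

lemma card_matching_le_cover:
  assumes "pairwise disjnt M" "finite C" "\<And>e. e \<in> M \<Longrightarrow> e \<inter> C \<noteq> {}"
  shows "card M \<le> card C"
proof -
  have "\<forall>e\<in>M. \<exists>v. v \<in> e \<inter> C" using assms(3) by blast
  then obtain f where f: "\<And>e. e \<in> M \<Longrightarrow> f e \<in> e \<inter> C" by metis
  have "inj_on f M"
  proof (rule inj_onI, rule ccontr)
    fix x y assume xy: "x \<in> M" "y \<in> M" "f x = f y" "x \<noteq> y"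
    then have "x \<inter> y = {}" using pairwiseD(1)[OF assms(1)] by (simp add: disjnt_def)
    then show False using f[OF xy(1)] f[OF xy(2)] xy(3) by auto
  qed
  moreover have "f ` M \<subseteq> C" using f by blast
  ultimately show ?thesis by (rule card_inj_on_le[OF _ _ assms(2)])
qed

text \<open>If every vertex of \<open>X\<close> is adjacent to every vertex of \<open>Y\<close>, one remaining vertex of each connects
everything that remains.\<close>

lemma cut_of_join:
  assumes c: "cut V F A S B" and V: "V = X \<union> Y"
    and join: "\<And>x y. x \<in> X \<Longrightarrow> y \<in> Y \<Longrightarrow> {x, y} \<in> F"
  shows "X \<subseteq> S \<or> Y \<subseteq> S"
proof (rule ccontr)
  assume "\<not> ?thesis"
  then obtain x y where xy: "x \<in> X" "x \<notin> S" "y \<in> Y" "y \<notin> S" by blast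
  have impossible: False if c: "cut V F A S B" and "x \<in> A" for A B
  proof -
    have parts: "A \<union> S \<union> B = V" "A \<inter> B = {}" "S \<inter> B = {}" using c unfolding cut_def by auto
    have Y: "z \<notin> B" if "z \<in> Y" for z using cut_no_edge[OF c \<open>x \<in> A\<close> join[OF xy(1) that]] .
    then have "y \<in> A" using xy parts V by blast
    moreover obtain b where "b \<in> B" using c unfolding cut_def by blast
    moreover from this have "b \<in> X" using Y parts V by blast
    ultimately show False using cut_no_edge[OF cut_sym[OF c] _ join[OF _ xy(3)]] by blast
  qed
  have "x \<in> A \<or> x \<in> B" using c xy V unfolding cut_def by blast
  then show False using impossible[OF c] impossible[OF cut_sym[OF c]] by blast
qed

section \<open>Upper bounds\<close>

definition biclique :: "nat \<Rightarrow> nat ugraph" where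
  "biclique d = \<lparr>verts = {..<2 * d}, edges = {{i, j} | i j. i < d \<and> d \<le> j \<and> j < 2 * d}\<rparr>"

text \<open>The complete bipartite graph with sides of size \<open>d\<close> has no matching with more than \<open>d\<close> edges.\<close>

lemma guaranteed_le_min_degree:
  assumes k: "1 \<le> k" "k < d" and g: "guaranteed k d l"
  shows "l \<le> d"
proof -
  let ?G = "biclique d"
  have V: "verts ?G = {..<d} \<union> {d..<2 * d}" by (auto simp: biclique_def)
  have join: "{i, j} \<in> edges ?G" if "i \<in> {..<d}" "j \<in> {d..<2 * d}" for i j
    using that by (auto simp: biclique_def)
  have simple: "simple_graph ?G" by (auto simp: simple_graph_def biclique_def)
  have "kcon k (verts ?G) (edges ?G)"
    unfolding kcon_def
  proof (intro allI impI)
    fix A S B assume c: "cut (verts ?G) (edges ?G) A S B"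
    then have "A \<union> S \<union> B = verts ?G" unfolding cut_def by blast
    then have "finite (A \<union> S \<union> B)" by (simp add: biclique_def)
    then have "finite S" by simp
    then show "k \<le> card S"
      using cut_of_join[OF c V join] card_mono[of S "{..<d}"] card_mono[of S "{d..<2 * d}"] k by fastforce
  qed
  then have conn: "k_connected k ?G"
    using k_connected_iff_kcon[OF simple] k by (simp add: biclique_def)
  have "d \<le> card (nbrs (edges ?G) v)" if v: "v \<in> verts ?G" for v
  proof -
    have fin: "finite (nbrs (edges ?G) v)"
      using nbrs_subset[of "edges ?G" "verts ?G" v] simple finite_subset
      by (fastforce simp: simple_graph_def)
    show ?thesis
    proof (cases "v < d")
      case True
      then have "{d..<2 * d} \<subseteq> nbrs (edges ?G) v" using join by (auto simp: nbrs_iff)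
      from card_mono[OF fin this] show ?thesis by simp
    next
      case False
      then have "{..<d} \<subseteq> nbrs (edges ?G) v"
        using join[of _ v] v V by (auto simp: nbrs_iff insert_commute)
      from card_mono[OF fin this] show ?thesis by simp
    qed
  qed
  moreover have "0 \<in> verts ?G" using k by (simp add: biclique_def)
  ultimately have "d \<le> min_degree ?G" using min_degree_ge_iff[OF simple] by blast
  moreover have "card (verts ?G) = 2 * d" by (simp add: biclique_def)
  ultimately obtain M where M: "removable_matching k ?G M" "card M = l"
    using g simple conn unfolding guaranteed_def by fastforce
  then have "M \<subseteq> edges ?G" "pairwise disjnt M" by (auto simp: removable_matching_def matching_def)
  then have "card M \<le> card {..<d}"
    by (intro card_matching_le_cover) (auto simp: biclique_def)
  then show ?thesis using M(2) by simp
qed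

text \<open>The rim consists of the vertices \<open>p, \<dots>, 2 * p + 3\<close> in cyclic order. An edge is indexed by
its first end, so that the last index wraps around to \<open>p\<close>.\<close>

definition rim_edge :: "nat \<Rightarrow> nat \<Rightarrow> nat set" where
  "rim_edge p i = {i, if i = 2 * p + 3 then p else Suc i}"

text \<open>The join of \<open>p\<close> independent hubs with a cycle of length \<open>p + 4\<close>; for \<open>p = 1\<close> this is a wheel. The
length makes the number of vertices exactly \<open>2 * (p + 2)\<close>.\<close>

definition hub_cycle :: "nat \<Rightarrow> nat ugraph" where
  "hub_cycle p = \<lparr>verts = {..<2 * p + 4},
     edges = {{h, i} | h i. h < p \<and> p \<le> i \<and> i < 2 * p + 4} \<union> rim_edge p ` {p..2 * p + 3}\<rparr>"

text \<open>The \<open>p\<close> hubs do not separate the graph, but they do once two rim edges are gone. Hence a removable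
matching has at most one rim edge, and every other edge uses up one of the \<open>p\<close> hubs.\<close>

lemma guaranteed_le_connectivity:
  assumes g: "guaranteed (Suc p) (p + 2) l"
  shows "l \<le> Suc p"
proof -
  let ?G = "hub_cycle p"
  have V: "verts ?G = {..<p} \<union> {p..<2 * p + 4}" by (auto simp: hub_cycle_def)
  have finV: "finite (verts ?G)" by (simp add: hub_cycle_def)
  have spoke: "{h, i} \<in> edges ?G" if "h \<in> {..<p}" "i \<in> {p..<2 * p + 4}" for h i
    using that by (auto simp: hub_cycle_def)
  have rim: "rim_edge p i \<in> edges ?G" if "p \<le> i" "i \<le> 2 * p + 3" for i
    using that by (auto simp: hub_cycle_def)
  have simple: "simple_graph ?G" by (auto simp: simple_graph_def hub_cycle_def rim_edge_def)
  have kcon: "kcon (Suc p) (verts ?G) (edges ?G)"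
    unfolding kcon_def
  proof (intro allI impI, rule ccontr)
    fix A S B assume c: "cut (verts ?G) (edges ?G) A S B" and "\<not> Suc p \<le> card S"
    then have S: "card S \<le> p" by simp
    have parts: "A \<union> S \<union> B = verts ?G" "A \<inter> S = {}" "S \<inter> B = {}" "A \<noteq> {}" "B \<noteq> {}"
      using c unfolding cut_def by auto
    then have "finite (A \<union> S \<union> B)" using finV by simp
    then have fS: "finite S" by simp
    have "\<not> {p..<2 * p + 4} \<subseteq> S" using card_mono[OF fS, of "{p..<2 * p + 4}"] S by auto
    then have "{..<p} \<subseteq> S" using cut_of_join[OF c V spoke] by blast
    then have "S = {..<p}" using S fS card_seteq[of S "{..<p}"] by simp
    then have AB: "A \<union> B = {p..<2 * p + 4}" using parts V by auto
    have rim_path: "{p..<2 * p + 4} \<subseteq> C" if c: "cut (verts ?G) (edges ?G) C S D" and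
      CD: "C \<union> D = {p..<2 * p + 4}" and "p \<in> C" for C D
    proof
      fix i assume "i \<in> {p..<2 * p + 4}"
      then have "p \<le> i" "i < 2 * p + 4" by auto
      then show "i \<in> C"
      proof (induction i rule: dec_induct)
        case base
        show ?case by fact
      next
        case (step i)
        then have "{i, Suc i} \<in> edges ?G" using rim[of i] by (simp add: rim_edge_def)
        then have "Suc i \<notin> D" using cut_no_edge[OF c] step by simp
        moreover have "Suc i \<in> C \<union> D" using step CD by simp
        ultimately show ?case by blast
      qed
    qed
    have "A \<inter> B = {}" using c unfolding cut_def by blast
    moreover have "p \<in> A \<union> B" using AB by simp
    ultimately show False
      using rim_path[OF c AB] rim_path[OF cut_sym[OF c]] AB parts(4,5) by blast
  qed
  have two_rim: "i = j" if M: "pairwise disjnt M" "kcon (Suc p) (verts ?G) (edges ?G - M)"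
    and ij: "rim_edge p i \<in> M" "rim_edge p j \<in> M" "p \<le> i" "i \<le> j" "j \<le> 2 * p + 3" for M i j
  proof (rule ccontr)
    assume "i \<noteq> j"
    \<comment> \<open>Deleting the rim edges with indices i and j cuts the cycle into the arc from i + 1 to j
      and its complement.\<close>
    have "cut (verts ?G) (edges ?G - M) {Suc i..j} {..<p} ({p..<2 * p + 4} - {Suc i..j})"
      unfolding cut_def
    proof (intro conjI ballI)
      show "{Suc i..j} \<union> {..<p} \<union> ({p..<2 * p + 4} - {Suc i..j}) = verts ?G"
        unfolding V using ij by auto
      show "{Suc i..j} \<inter> {..<p} = {}" "{Suc i..j} \<noteq> {}" using ij \<open>i \<noteq> j\<close> by auto
      have "p \<in> {p..<2 * p + 4} - {Suc i..j}" using ij by simp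
      then show "{p..<2 * p + 4} - {Suc i..j} \<noteq> {}" by blast
      show "{Suc i..j} \<inter> ({p..<2 * p + 4} - {Suc i..j}) = {}" by blast
      show "{..<p} \<inter> ({p..<2 * p + 4} - {Suc i..j}) = {}" by auto
      fix x y assume x: "x \<in> {Suc i..j}" and y: "y \<in> {p..<2 * p + 4} - {Suc i..j}"
      show "{x, y} \<notin> edges ?G - M"
      proof
        assume xy: "{x, y} \<in> edges ?G - M"
        have "\<not> x < p" "\<not> y < p" using x y ij by auto
        then have "{x, y} \<in> rim_edge p ` {p..2 * p + 3}"
          using xy by (auto simp: hub_cycle_def doubleton_eq_iff)
        then obtain t where t: "{x, y} = rim_edge p t" "p \<le> t" "t \<le> 2 * p + 3" by auto
        then have "t = i \<or> t = j"
          using x y ij by (auto simp: rim_edge_def doubleton_eq_iff split: if_splits)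
        then show False using t xy ij by auto
      qed
    qed
    then have "Suc p \<le> card {..<p}" using M(2) unfolding kcon_def by blast
    then show False by simp
  qed
  have conn: "k_connected (Suc p) ?G"
    using k_connected_iff_kcon[OF simple] kcon by (simp add: hub_cycle_def)
  have "p + 2 \<le> card (nbrs (edges ?G) v)" if v: "v \<in> verts ?G" for v
  proof -
    have fin: "finite (nbrs (edges ?G) v)"
      using nbrs_subset[of "edges ?G" "verts ?G" v] simple finite_subset
      by (fastforce simp: simple_graph_def)
    show ?thesis
    proof (cases "v < p")
      case True
      then have "{p..<2 * p + 4} \<subseteq> nbrs (edges ?G) v" using spoke by (auto simp: nbrs_iff)
      from card_mono[OF fin this] show ?thesis by simp
    next
      case False
      \<comment> \<open>The successor and the predecessor of v on the rim.\<close>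
      define s where "s = (if v = 2 * p + 3 then p else Suc v)"
      define t where "t = (if v = p then 2 * p + 3 else v - 1)"
      have v': "p \<le> v" "v \<le> 2 * p + 3" using False v V by auto
      have "{v, s} \<in> edges ?G" using rim[OF v'] by (simp add: rim_edge_def s_def)
      moreover have "rim_edge p t = {v, t}" using v' by (auto simp: rim_edge_def t_def)
      then have "{v, t} \<in> edges ?G" using rim[of t] v' by (auto simp: t_def split: if_splits)
      ultimately have "insert s (insert t {..<p}) \<subseteq> nbrs (edges ?G) v"
        using spoke[of _ v] v' by (auto simp: nbrs_iff insert_commute)
      then have "card (insert s (insert t {..<p})) \<le> card (nbrs (edges ?G) v)"
        by (rule card_mono[OF fin])
      moreover have "s \<noteq> t" "\<not> s < p" "\<not> t < p" using v' by (auto simp: s_def t_def)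
      ultimately show ?thesis by simp
    qed
  qed
  moreover have "0 \<in> verts ?G" by (simp add: hub_cycle_def)
  ultimately have "p + 2 \<le> min_degree ?G" using min_degree_ge_iff[OF simple] by blast
  moreover have "card (verts ?G) = 2 * (p + 2)" by (simp add: hub_cycle_def)
  ultimately obtain M where M: "removable_matching (Suc p) ?G M" "card M = l"
    using g simple conn unfolding guaranteed_def by fastforce
  have "Suc p < card (verts ?G)" by (simp add: hub_cycle_def)
  then have M': "M \<subseteq> edges ?G" "pairwise disjnt M" "kcon (Suc p) (verts ?G) (edges ?G - M)"
    using M(1) removable_matching_iff[OF simple] by auto
  define Q where "Q = M \<inter> rim_edge p ` {p..2 * p + 3}"
  have fin: "finite Q" by (simp add: Q_def)
  have "card Q \<le> 1"
  proof -
    have "e = f" if ef: "e \<in> Q" "f \<in> Q" for e f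
    proof -
      obtain i j where ij: "e = rim_edge p i" "f = rim_edge p j" "p \<le> i" "i \<le> 2 * p + 3" "p \<le> j" "j \<le> 2 * p + 3"
        using ef unfolding Q_def by auto
      have "i = j"
        using two_rim[OF M'(2,3), of i j] two_rim[OF M'(2,3), of j i] ij ef
        by (cases "i \<le> j") (auto simp: Q_def)
      then show ?thesis using ij by simp
    qed
    then show ?thesis using card_le_Suc0_iff_eq[OF fin] by auto
  qed
  moreover have "card (M - Q) \<le> card {..<p}"
  proof (rule card_matching_le_cover)
    show "pairwise disjnt (M - Q)" by (rule pairwise_subset[OF M'(2)]) blast
    show "e \<inter> {..<p} \<noteq> {}" if "e \<in> M - Q" for e
      using that M'(1) by (auto simp: Q_def hub_cycle_def)
  qed simp
  moreover have "card M \<le> card (M - Q) + card Q"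
    using card_Un_le[of "M - Q" Q] by (simp add: Q_def Un_Diff_Int)
  ultimately show ?thesis using M(2) by simp
qed

section \<open>The extremal function\<close>

lemma max_removable_greatest:
  assumes "1 \<le> k" "k < d"
  shows guaranteed_max_removable: "guaranteed k d (max_removable k d)"
    and max_removable_ge: "guaranteed k d l \<Longrightarrow> l \<le> max_removable k d"
proof -
  have eq: "max_removable k d = (GREATEST l. guaranteed k d l)"
    by (simp add: max_removable_def guaranteed_def)
  show "guaranteed k d (max_removable k d)"
    unfolding eq using guaranteed_0[OF assms] guaranteed_le_min_degree[OF assms]
    by (rule GreatestI_nat)
  show "l \<le> max_removable k d" if "guaranteed k d l"
    unfolding eq using that guaranteed_le_min_degree[OF assms] by (rule Greatest_le_nat)
qed

lemma max_removable_le_min_degree: "1 \<le> k \<Longrightarrow> k < d \<Longrightarrow> max_removable k d \<le> d"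
  using guaranteed_le_min_degree guaranteed_max_removable by blast

lemma max_removable_le_connectivity: "1 \<le> k \<Longrightarrow> max_removable k (k + 1) \<le> k"
  using guaranteed_le_connectivity[of "k - 1"] guaranteed_max_removable[of k "k + 1"] by simp

lemma max_removable_general:
  assumes "1 \<le> k" "k < d" "2 * l + k + 1 \<le> 2 * d"
  shows "l \<le> max_removable k d"
  using max_removable_ge[OF assms(1,2)] guaranteed_general[OF assms] by blast

lemma max_removable_connected: "3 \<le> d \<Longrightarrow> max_removable 1 d = d"
  using max_removable_ge[OF _ _ guaranteed_connected[of d]] max_removable_le_min_degree[of 1 d] by force

text \<open>For \<open>k = 1\<close> and \<open>\<delta> = 2\<close> the extremal graph is the cycle of length 4.\<close>

lemma max_removable_1_2: "max_removable 1 2 = 1"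
  using max_removable_general[of 1 2 1] max_removable_le_connectivity[of 1] by (simp add: numeral_2_eq_2)

lemma max_removable_2_3: "max_removable 2 3 = 2"
  using max_removable_ge[OF _ _ guaranteed_2_3] max_removable_le_connectivity[of 2] by simp

theorem theorem1p10:
  fixes k \<delta> :: nat
  assumes "\<delta> > k" and "k \<ge> 1"
  shows
    "(\<delta> \<ge> 3 * k - 1 \<longrightarrow>
        ((k, \<delta>) \<noteq> (1, 2) \<longrightarrow> (real \<delta> + 1) / 2 \<le> real (max_removable k \<delta>)) \<and>
        max_removable k \<delta> \<le> \<delta>) \<and>
     ((\<delta> = 2 \<longrightarrow> max_removable 1 \<delta> = 1) \<and>
        (\<delta> \<ge> 3 \<longrightarrow> max_removable 1 \<delta> = \<delta>)) \<and>
     (\<delta> > 2 \<longrightarrow>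
        2 * \<lfloor>(real \<delta> - 2) / 2\<rfloor> \<le> int (max_removable 2 \<delta>) \<and> max_removable 2 \<delta> \<le> \<delta>) \<and>
     ((k \<ge> 2 \<longrightarrow> 2 \<le> max_removable k (k + 1) \<and> max_removable k (k + 1) \<le> k) \<and>
        max_removable 2 3 = 2)"
proof -
  have i: "(real \<delta> + 1) / 2 \<le> real (max_removable k \<delta>)" if "3 * k - 1 \<le> \<delta>" "(k, \<delta>) \<noteq> (1, 2)"
  proof (cases "k = 1")
    case True
    then have "3 \<le> \<delta>" using assms that by auto
    then show ?thesis using max_removable_connected True by simp
  next
    case False
    \<comment> \<open>One edge more than half of the minimum degree is needed, and the general bound just
      allows it, since the minimum degree is at least k + 3.\<close>
    define h where "h = \<delta> div 2"
    have h: "2 * h \<le> \<delta>" "\<delta> \<le> 2 * h + 1" by (auto simp: h_def)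
    have "k + 3 \<le> \<delta>" using False assms that(1) by simp
    then have "2 * (h + 1) + k + 1 \<le> 2 * \<delta>" using h(1) by simp
    then have "h + 1 \<le> max_removable k \<delta>" using max_removable_general assms by simp
    then have "\<delta> + 1 \<le> 2 * max_removable k \<delta>" using h(2) by linarith
    then have "real (\<delta> + 1) \<le> real (2 * max_removable k \<delta>)" by (simp only: of_nat_le_iff)
    then show ?thesis by simp
  qed
  have iii: "2 * \<lfloor>(real \<delta> - 2) / 2\<rfloor> \<le> int (max_removable 2 \<delta>)" if "2 < \<delta>"
  proof -
    have "\<delta> - 2 \<le> max_removable 2 \<delta>" using that by (intro max_removable_general) auto
    then have "real \<delta> - 2 \<le> real (max_removable 2 \<delta>)" using that by linarith
    moreover have "real_of_int (2 * \<lfloor>(real \<delta> - 2) / 2\<rfloor>) \<le> real \<delta> - 2"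
      using of_int_floor_le[of "(real \<delta> - 2) / 2"] by simp
    ultimately have "real_of_int (2 * \<lfloor>(real \<delta> - 2) / 2\<rfloor>) \<le> real (max_removable 2 \<delta>)" by linarith
    then show ?thesis by linarith
  qed
  have iv: "2 \<le> max_removable k (k + 1)" if "2 \<le> k"
  proof (cases "k = 2")
    case True
    then show ?thesis using max_removable_2_3 by simp
  next
    case False
    then show ?thesis using that by (intro max_removable_general) auto
  qed
  show ?thesis
    using i iii iv max_removable_le_min_degree[OF assms(2,1)] max_removable_le_min_degree[of 2 \<delta>]
      max_removable_1_2 max_removable_connected max_removable_le_connectivity[OF assms(2)] max_removable_2_3
    by auto
qed

end
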